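(* Let $\mathbb{K}\in\{\mathbb{R},\mathbb{C}\}$. For a differential equation $\dot x(t)=Ax(t)$ with $A\in\mathbb{K}^{n\times n}$, the chain recurrent set of its flow $\psi(t,x)=e^{At}x$ on $\mathbb{K}^n$ coincides with the center Lyapunov space $L^0$ of $A$.
   Context: $L^0$ is the sum of the generalized eigenspaces of $A$ (the real generalized eigenspaces if $\mathbb{K}=\mathbb{R}$) for eigenvalues with vanishing real part. $\mathbb{K}^n$ carries the metric given by a norm. For $\varepsilon,T>0$ an $(\varepsilon,T)$-chain of $\psi$ from $x$ to $y$ is given by $k\in\mathbb{N}$, times $T_0,\ldots,T_{k-1}\ge T$ and points $x_0=x,x_1,\ldots,x_k=y\in\mathbb{K}^n$ with $\|\psi(T_i,x_i)-x_{i+1}\|<\varepsilon$ for $i=0,\ldots,k-1$. A point $x$ is chain recurrent if for all $\varepsilon,T>0$ there is an $(\varepsilon,T)$-chain from $x$ to $x$; the chain recurrent set is the set of all chain recurrent points. *)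

theory Defs
  imports "HOL-Analysis.Analysis"
begin

text \<open>The library multiplication \<open>*\<close> (hence \<open>^\<close>) on the type of matrices is entrywise,
  so powers and the exponential are defined here with respect to the matrix product \<open>**\<close>.\<close>

primrec matrix_power :: "'a::semiring_1^'n^'n \<Rightarrow> nat \<Rightarrow> 'a^'n^'n" where
  "matrix_power A 0 = mat 1"
| "matrix_power A (Suc k) = A ** matrix_power A k"

definition matrix_exp :: "'a::real_normed_field^'n^'n \<Rightarrow> 'a^'n^'n" where
  "matrix_exp A = (\<Sum>k. (1 / fact k) *\<^sub>R matrix_power A k)"

definition linear_flow :: "'a::real_normed_field^'n^'n \<Rightarrow> real \<Rightarrow> 'a^'n \<Rightarrow> 'a^'n" where
  "linear_flow A t x = matrix_exp (t *\<^sub>R A) *v x"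

text \<open>An arbitrary norm on \<open>'a^'n\<close> as a vector space over \<open>'a\<close>
  (nonnegativity follows from the other properties).\<close>

definition is_vec_norm :: "('a::real_normed_field^'n \<Rightarrow> real) \<Rightarrow> bool" where
  "is_vec_norm N \<longleftrightarrow>
     (\<forall>x. N x = 0 \<longleftrightarrow> x = 0) \<and>
     (\<forall>c x. N (c *s x) = norm c * N x) \<and>
     (\<forall>x y. N (x + y) \<le> N x + N y)"

text \<open>Chains have at least one step: the empty chain would make every point chain recurrent.\<close>

definition is_chain ::
  "('v::ab_group_add \<Rightarrow> real) \<Rightarrow> (real \<Rightarrow> 'v \<Rightarrow> 'v) \<Rightarrow> real \<Rightarrow> real \<Rightarrow> 'v \<Rightarrow> 'v \<Rightarrow> bool" where
  "is_chain N \<psi> \<epsilon> T x y \<longleftrightarrow>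
     (\<exists>k\<ge>1. \<exists>(\<tau> :: nat \<Rightarrow> real) (\<xi> :: nat \<Rightarrow> 'v).
        \<xi> 0 = x \<and> \<xi> k = y \<and>
        (\<forall>i<k. \<tau> i \<ge> T \<and> N (\<psi> (\<tau> i) (\<xi> i) - \<xi> (Suc i)) < \<epsilon>))"

definition chain_recurrent_set ::
  "('v::ab_group_add \<Rightarrow> real) \<Rightarrow> (real \<Rightarrow> 'v \<Rightarrow> 'v) \<Rightarrow> 'v set" where
  "chain_recurrent_set N \<psi> = {x. \<forall>\<epsilon>>0. \<forall>T>0. is_chain N \<psi> \<epsilon> T x x}"

definition eigenvalue :: "'a::field^'n^'n \<Rightarrow> 'a \<Rightarrow> bool" where
  "eigenvalue A \<mu> \<longleftrightarrow> (\<exists>v. v \<noteq> 0 \<and> A *v v = \<mu> *s v)"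

definition gen_eigenspace :: "'a::field^'n^'n \<Rightarrow> 'a \<Rightarrow> ('a^'n) set" where
  "gen_eigenspace A \<mu> = {v. \<exists>k. matrix_power (A - mat \<mu>) k *v v = 0}"

definition center_space_complex :: "complex^'n^'n \<Rightarrow> (complex^'n) set" where
  "center_space_complex A =
     vec.span (\<Union>\<mu>\<in>{\<mu>. eigenvalue A \<mu> \<and> Re \<mu> = 0}. gen_eigenspace A \<mu>)"

text \<open>The eigenvalues of a real matrix are those of its complexification. The real generalized
  eigenspace for \<open>\<mu>\<close> is the real span of the real and imaginary parts of the complex generalized
  eigenvectors; it is the same for \<open>\<mu>\<close> and \<open>cnj \<mu>\<close>, and for real \<open>\<mu>\<close> it is the usual
  generalized eigenspace in \<open>real^'n\<close>.\<close>

abbreviation complexify :: "real^'n^'n \<Rightarrow> complex^'n^'n" where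
  "complexify A \<equiv> map_matrix complex_of_real A"

definition real_gen_eigenspace :: "real^'n^'n \<Rightarrow> complex \<Rightarrow> (real^'n) set" where
  "real_gen_eigenspace A \<mu> =
     span (\<Union>v\<in>gen_eigenspace (complexify A) \<mu>. {\<chi> i. Re (v $ i), \<chi> i. Im (v $ i)})"

definition center_space_real :: "real^'n^'n \<Rightarrow> (real^'n) set" where
  "center_space_real A =
     span (\<Union>\<mu>\<in>{\<mu>. eigenvalue (complexify A) \<mu> \<and> Re \<mu> = 0}. real_gen_eigenspace A \<mu>)"

end

theory Submission
  imports Defs "HOL-Computational_Algebra.Fundamental_Theorem_Algebra"
begin

text \<open>Chain recurrence is pushed forward by every bounded linear map that intertwines two flows, with no
  relation required between the dimensions or the scalar fields (\<open>chain_recurrent_image\<close>). This single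
  principle removes the choice of the norm, lets spectral projections act on the problem, and
  transports the complex result to real matrices, through the embedding of \<open>\<real>\<^sup>n\<close> in \<open>\<complex>\<^sup>n\<close> one
  way and through the real part the other way. So let \<open>A\<close> be complex.

  The identity is a sum of matrices \<open>P\<close> that commute with \<open>A\<close> and map into one generalized eigenspace
  (\<open>one_spectral\<close>). If \<open>x\<close> is chain recurrent, so is \<open>P x\<close>, by a chain that stays inside that
  eigenspace. There the flow is \<open>e\<^sup>\<mu>\<^sup>t\<close> times a polynomial in \<open>t\<close>, so for \<open>Re \<mu> \<noteq> 0\<close> and large times
  it at least halves or at least doubles all norms. A closed chain with jumps below \<open>\<delta>\<close> under such a map
  cannot start farther than \<open>2 \<delta>\<close> from the origin; hence \<open>P x = 0\<close>
  (\<open>hyperbolic_projection_zero\<close>), and only the components in the center space survive.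

  Conversely, fix one time \<open>T\<close> and use it for every step of a chain. The points that can be joined to
  the origin in both directions with arbitrarily small jumps form a subspace, because chains for a
  linear map can be added once they have been padded to the same length by resting at the origin. For
  \<open>Re \<mu> = 0\<close> this subspace contains the kernel of \<open>(A - \<mu>)\<^sup>k\<close>, by induction on \<open>k\<close>: modulo the kernel
  of \<open>(A - \<mu>)\<^sup>k\<^sup>-\<^sup>1\<close> the time-\<open>T\<close> map is a rotation, so a vector can be shrunk to zero or
  grown from zero by many equal small jumps, up to an error that the induction hypothesis removes
  (\<open>null_connected_extend\<close>). Going to the origin and back gives the closed chain.\<close>

section \<open>The flow as a power series\<close>

lemma matrix_power_Suc_right: "matrix_power A (Suc k) = matrix_power A k ** A"
  by (induction k) (simp_all add: matrix_mul_assoc)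

lemma matrix_power_scaleR:
  fixes A :: "'a::real_algebra_1^'n^'n"
  shows "matrix_power (t *\<^sub>R A) k = t ^ k *\<^sub>R matrix_power A k"
  by (induction k) (simp_all add: scalar_matrix_assoc[symmetric] matrix_scalar_ac)

lemma scaleR_eq_vector_mult: "r *\<^sub>R (x :: 'a::real_algebra_1^'n) = of_real r *s x"
  unfolding vec_eq_iff vector_scaleR_component vector_smult_component
  by (simp add: scaleR_conv_of_real)

lemma norm_vector_mult:
  fixes x :: "'a::real_normed_field^'n"
  shows "norm (c *s x) = norm c * norm x"
  by (simp add: norm_vec_def norm_mult L2_set_right_distrib)

lemma scaleR_matrix_vector:
  fixes M :: "'a::real_algebra_1^'n^'m"
  shows "(r *\<^sub>R M) *v x = r *\<^sub>R (M *v x)"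
  by (simp add: vec_eq_iff matrix_vector_mult_def scaleR_sum_right)

lemma matrix_power_entry_bound:
  fixes A :: "'a::real_normed_field^'n^'n"
  shows "norm (matrix_power A k $ i $ j) \<le> (\<Sum>p\<in>UNIV. \<Sum>q\<in>UNIV. norm (A $ p $ q)) ^ k"
    (is "_ \<le> ?c ^ k")
proof (induction k arbitrary: i)
  case 0
  show ?case by (simp add: mat_def)
next
  case (Suc k)
  have c0: "0 \<le> ?c" by (intro sum_nonneg norm_ge_zero)
  have "norm (matrix_power A (Suc k) $ i $ j)
      \<le> (\<Sum>q\<in>UNIV. norm (A $ i $ q) * norm (matrix_power A k $ q $ j))"
    by (simp add: matrix_matrix_mult_def norm_sum order_trans[OF norm_sum] norm_mult[symmetric])
  also have "\<dots> \<le> (\<Sum>q\<in>UNIV. norm (A $ i $ q) * ?c ^ k)"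
    by (intro sum_mono mult_left_mono Suc.IH norm_ge_zero)
  also have "\<dots> = (\<Sum>q\<in>UNIV. norm (A $ i $ q)) * ?c ^ k"
    by (simp add: sum_distrib_right)
  also have "\<dots> \<le> ?c * ?c ^ k"
    by (intro mult_right_mono member_le_sum) (auto intro: sum_nonneg simp: c0)
  finally show ?case by simp
qed

text \<open>The entries of the powers grow at most geometrically, so a constant multiple of the exponential
  series of a number dominates.\<close>

lemma summable_matrix_exp:
  fixes A :: "'a::{real_normed_field,euclidean_space}^'n^'n"
  shows "summable (\<lambda>k. (1 / fact k) *\<^sub>R matrix_power A k)"
proof -
  define c where "c = (\<Sum>p\<in>UNIV. \<Sum>q\<in>UNIV. norm (A $ p $ q))"
  have bound: "norm ((1 / fact k) *\<^sub>R matrix_power A k)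
      \<le> of_nat CARD('n) * of_nat CARD('n) * (inverse (fact k) * c ^ k)" for k
  proof -
    have "norm (matrix_power A k) \<le> (\<Sum>i\<in>UNIV. norm (matrix_power A k $ i))"
      unfolding norm_vec_def[of "matrix_power A k"] by (rule L2_set_le_sum) simp
    also have "\<dots> \<le> (\<Sum>i\<in>UNIV. \<Sum>j\<in>UNIV. norm (matrix_power A k $ i $ j))"
    proof (rule sum_mono)
      fix i
      show "norm (matrix_power A k $ i) \<le> (\<Sum>j\<in>UNIV. norm (matrix_power A k $ i $ j))"
        unfolding norm_vec_def[of "matrix_power A k $ i"] by (rule L2_set_le_sum) simp
    qed
    also have "\<dots> \<le> (\<Sum>(i::'n)\<in>UNIV. \<Sum>(j::'n)\<in>UNIV. c ^ k)"
      unfolding c_def by (intro sum_mono matrix_power_entry_bound)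
    also have "\<dots> = of_nat CARD('n) * of_nat CARD('n) * c ^ k"
      by simp
    finally have "norm (matrix_power A k) \<le> of_nat CARD('n) * of_nat CARD('n) * c ^ k" .
    from mult_left_mono[OF this, of "inverse (fact k)"] show ?thesis
      by (simp add: field_simps)
  qed
  show ?thesis
  proof (rule summable_comparison_test', rule summable_mult)
    show "summable (\<lambda>k. inverse (fact k) * c ^ k)" by (rule summable_exp)
  qed (use bound in blast)
qed

lemma linear_flow_sums:
  fixes A :: "'a::{real_normed_field,euclidean_space}^'n^'n"
  shows "(\<lambda>k. (t ^ k / fact k) *\<^sub>R (matrix_power A k *v x)) sums linear_flow A t x"
proof -
  have "(\<lambda>k. (1 / fact k) *\<^sub>R matrix_power (t *\<^sub>R A) k) sums matrix_exp (t *\<^sub>R A)"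
    unfolding matrix_exp_def by (rule summable_sums[OF summable_matrix_exp])
  \<comment> \<open>evaluation at a vector is continuous, so the matrix series may be applied termwise\<close>
  moreover have "bounded_linear (\<lambda>M :: 'a^'n^'n. M *v x)"
    unfolding linear_conv_bounded_linear[symmetric]
    by (intro linearI) (simp_all add: matrix_vector_mult_add_rdistrib scaleR_matrix_vector)
  ultimately have "(\<lambda>k. ((1 / fact k) *\<^sub>R matrix_power (t *\<^sub>R A) k) *v x) sums linear_flow A t x"
    unfolding linear_flow_def using bounded_linear.sums by blast
  then show ?thesis
    by (simp add: matrix_power_scaleR scaleR_matrix_vector)
qed

text \<open>\<open>\<phi>\<close> intertwines all powers of \<open>A\<close> and \<open>B\<close>, hence the partial sums of the exponential series, and
  continuity passes this on to the limit. The two scalar fields may differ, which the passage between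
  real and complex matrices relies on.\<close>

lemma linear_flow_intertwine:
  fixes A :: "'a::{real_normed_field,euclidean_space}^'n^'n"
    and B :: "'b::{real_normed_field,euclidean_space}^'m^'m"
  assumes \<phi>: "bounded_linear \<phi>" and comm: "\<And>x. \<phi> (A *v x) = B *v \<phi> x"
  shows "\<phi> (linear_flow A t x) = linear_flow B t (\<phi> x)"
proof -
  interpret bounded_linear \<phi> by fact
  have pow: "\<phi> (matrix_power A k *v x) = matrix_power B k *v \<phi> x" for k
    by (induction k) (simp_all add: matrix_vector_mul_assoc[symmetric] comm)
  have "(\<lambda>k. \<phi> ((t ^ k / fact k) *\<^sub>R (matrix_power A k *v x))) sums \<phi> (linear_flow A t x)"
    by (rule sums) (rule linear_flow_sums)
  then have "(\<lambda>k. (t ^ k / fact k) *\<^sub>R (matrix_power B k *v \<phi> x)) sums \<phi> (linear_flow A t x)"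
    by (simp add: scaleR pow)
  then show ?thesis
    using linear_flow_sums by (rule sums_unique2)
qed

lemma linear_flow_commutes:
  fixes A P :: "'a::{real_normed_field,euclidean_space}^'n^'n"
  assumes "P ** A = A ** P"
  shows "P *v linear_flow A t x = linear_flow A t (P *v x)"
  by (rule linear_flow_intertwine[OF matrix_vector_mul_bounded_linear])
    (simp add: matrix_vector_mul_assoc assms)

section \<open>Chain recurrence under intertwining maps\<close>

text \<open>\<open>\<phi>\<close> maps the chain pointwise; the jumps grow by at most the factor \<open>C\<close>, so one starts from a chain
  with jumps below \<open>\<epsilon> / C\<close>.\<close>

lemma chain_recurrent_image:
  fixes \<phi> :: "'v::ab_group_add \<Rightarrow> 'w::ab_group_add"
  assumes diff: "\<And>x y. \<phi> (x - y) = \<phi> x - \<phi> y"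
    and flow: "\<And>t x. \<phi> (\<psi> t x) = \<psi>' t (\<phi> x)"
    and bound: "\<And>x. N' (\<phi> x) \<le> C * N x" and C: "C > 0"
    and x: "x \<in> chain_recurrent_set N \<psi>"
  shows "\<phi> x \<in> chain_recurrent_set N' \<psi>'"
  unfolding chain_recurrent_set_def mem_Collect_eq
proof (intro allI impI)
  fix \<epsilon> T :: real
  assume "\<epsilon> > 0" "T > 0"
  then have "is_chain N \<psi> (\<epsilon> / C) T x x"
    using x C by (simp add: chain_recurrent_set_def)
  then obtain k \<tau> \<xi> where k: "k \<ge> 1" and ends: "\<xi> 0 = x" "\<xi> k = x"
    and step: "\<And>i. i < k \<Longrightarrow> \<tau> i \<ge> T \<and> N (\<psi> (\<tau> i) (\<xi> i) - \<xi> (Suc i)) < \<epsilon> / C"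
    unfolding is_chain_def by blast
  have "N' (\<psi>' (\<tau> i) (\<phi> (\<xi> i)) - \<phi> (\<xi> (Suc i))) < \<epsilon>" if "i < k" for i
  proof -
    have "N' (\<psi>' (\<tau> i) (\<phi> (\<xi> i)) - \<phi> (\<xi> (Suc i)))
        \<le> C * N (\<psi> (\<tau> i) (\<xi> i) - \<xi> (Suc i))"
      using bound[of "\<psi> (\<tau> i) (\<xi> i) - \<xi> (Suc i)"] by (simp add: diff flow)
    also have "\<dots> < C * (\<epsilon> / C)"
      using step[OF that] C by (intro mult_strict_left_mono) auto
    finally show ?thesis using C by simp
  qed
  then show "is_chain N' \<psi>' \<epsilon> T (\<phi> x) (\<phi> x)"
    unfolding is_chain_def using k ends step
    by (intro exI[of _ k] conjI exI[of _ \<tau>] exI[of _ "\<phi> \<circ> \<xi>"]) auto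
qed

lemma vec_norm_le_norm:
  fixes N :: "'a::real_normed_field^'n \<Rightarrow> real"
  assumes "is_vec_norm N"
  shows "\<exists>C>0. \<forall>x. N x \<le> C * norm x"
proof -
  have scale: "N (c *s x) = norm c * N x" and triangle: "N (x + y) \<le> N x + N y"
    and zero: "N 0 = 0" for c x y
    using assms by (auto simp: is_vec_norm_def)
  have nonneg: "0 \<le> N x" for x
    using triangle[of x "(-1) *s x"] scale[of "-1" x] zero
    by (simp add: vector_sneg_minus1[symmetric])
  have sum_le: "N (sum f S) \<le> (\<Sum>i\<in>S. N (f i))" if "finite S" for f :: "'n \<Rightarrow> 'a^'n" and S
    using that by (induction S) (auto simp: zero intro: order_trans[OF triangle])
  define C where "C = (\<Sum>i\<in>UNIV. N (axis i 1)) + 1"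
  have "N x \<le> C * norm x" for x
  proof -
    have "N x \<le> (\<Sum>i\<in>UNIV. norm (x $ i) * N (axis i 1))"
      using sum_le[of UNIV "\<lambda>i. (x $ i) *s axis i 1"] by (simp add: basis_expansion scale)
    also have "\<dots> \<le> (\<Sum>i\<in>UNIV. norm x * N (axis i 1))"
      by (intro sum_mono mult_right_mono nonneg Finite_Cartesian_Product.norm_nth_le)
    also have "\<dots> \<le> C * norm x"
      by (simp add: C_def sum_distrib_left algebra_simps)
    finally show ?thesis .
  qed
  moreover have "C > 0"
    using sum_nonneg[of UNIV "\<lambda>i. N (axis i 1)"] nonneg by (simp add: C_def add_nonneg_pos)
  ultimately show ?thesis by blast
qed

text \<open>\<open>N\<close> is Lipschitz by the upper bound, so it attains a positive minimum on the compact unit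
  sphere, and homogeneity spreads this bound to the whole space.\<close>

lemma norm_le_vec_norm:
  fixes N :: "'a::{real_normed_field,euclidean_space}^'n \<Rightarrow> real"
  assumes "is_vec_norm N"
  shows "\<exists>C>0. \<forall>x. norm x \<le> C * N x"
proof -
  have scale: "N (c *s x) = norm c * N x" and triangle: "N (x + y) \<le> N x + N y"
    and zero: "N x = 0 \<longleftrightarrow> x = 0" for c x y
    using assms by (auto simp: is_vec_norm_def)
  have minus: "N (- x) = N x" for x
    using scale[of "-1" x] by (simp add: vector_sneg_minus1[symmetric])
  have nonneg: "0 \<le> N x" for x
    using triangle[of x "- x"] zero[of 0] minus[of x] by simp
  obtain C where "C > 0" and C: "\<And>x. N x \<le> C * norm x"
    using vec_norm_le_norm[OF assms] by blast
  have "C-lipschitz_on UNIV N"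
  proof (rule lipschitz_onI)
    fix x y :: "'a^'n"
    have "N x \<le> N y + N (x - y)" "N y \<le> N x + N (x - y)"
      using triangle[of y "x - y"] triangle[of x "y - x"] minus[of "x - y"] by simp_all
    then have "\<bar>N x - N y\<bar> \<le> N (x - y)" by linarith
    then show "dist (N x) (N y) \<le> C * dist x y"
      using C[of "x - y"] by (simp add: dist_norm)
  qed (use \<open>C > 0\<close> in simp)
  then have cont: "continuous_on (sphere 0 1) N"
    using lipschitz_on_continuous_on continuous_on_subset by blast
  have nonempty: "sphere (0 :: 'a^'n) 1 \<noteq> {}"
    by (metis dim_eq_0 ex_in_conv mem_sphere_0 vector_choose_size zero_le_one)
  obtain u where u: "norm u = 1" and min: "\<And>y. norm y = 1 \<Longrightarrow> N u \<le> N y"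
    using continuous_attains_inf[OF compact_sphere nonempty cont] by auto
  have pos: "N u > 0"
    using u nonneg[of u] zero[of u] by (cases "N u = 0") auto
  have "norm x \<le> inverse (N u) * N x" for x
  proof (cases "x = 0")
    case True
    then show ?thesis using zero[of 0] by simp
  next
    case False
    define y where "y = of_real (inverse (norm x)) *s x"
    have "norm y = 1" "N y = inverse (norm x) * N x"
      using False by (simp_all add: y_def norm_vector_mult scale norm_inverse)
    then have "N u \<le> inverse (norm x) * N x"
      using min by metis
    then show ?thesis using pos False by (simp add: field_simps)
  qed
  then show ?thesis using pos by (intro exI[of _ "inverse (N u)"]) auto
qed

text \<open>All norms are equivalent, so the identity map is an admissible \<open>\<phi>\<close> in both directions.\<close>

lemma chain_recurrent_set_vec_norm:
  fixes N :: "'a::{real_normed_field,euclidean_space}^'n \<Rightarrow> real"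
  assumes "is_vec_norm N"
  shows "chain_recurrent_set N \<psi> = chain_recurrent_set norm \<psi>"
proof -
  obtain C D where "C > 0" "\<And>x. N x \<le> C * norm x" "D > 0" "\<And>x. norm x \<le> D * N x"
    using vec_norm_le_norm[OF assms] norm_le_vec_norm[OF assms] by blast
  then show ?thesis
    using chain_recurrent_image[of "\<lambda>x. x" \<psi> \<psi> N C norm]
      chain_recurrent_image[of "\<lambda>x. x" \<psi> \<psi> norm D N] by blast
qed

section \<open>Spectral decomposition\<close>

lemma matrix_diff_ldistrib:
  fixes A :: "'a::ring_1^'n^'m"
  shows "A ** (B - C) = A ** B - A ** C"
  by (simp add: vec_eq_iff matrix_matrix_mult_def right_diff_distrib sum_subtractf)

lemma matrix_diff_rdistrib:
  fixes A :: "'a::ring_1^'n^'m"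
  shows "(A - B) ** C = A ** C - B ** C"
  by (simp add: vec_eq_iff matrix_matrix_mult_def left_diff_distrib sum_subtractf)

lemma matrix_sum_ldistrib:
  fixes A :: "'a::semiring_1^'n^'m"
  shows "A ** (\<Sum>i\<in>I. f i) = (\<Sum>i\<in>I. A ** f i)"
  by (induction I rule: infinite_finite_induct) (simp_all add: matrix_add_ldistrib)

lemma matrix_add_rdistrib:
  fixes A :: "'a::semiring_1^'n^'m"
  shows "(A + B) ** C = A ** C + B ** C"
  by (simp add: vec_eq_iff matrix_matrix_mult_def distrib_right sum.distrib)

lemma matrix_sum_rdistrib:
  fixes A :: "'a::semiring_1^'n^'m"
  shows "(\<Sum>i\<in>I. f i) ** A = (\<Sum>i\<in>I. f i ** A)"
  by (induction I rule: infinite_finite_induct) (simp_all add: matrix_add_rdistrib)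

lemma mat_mult_nth:
  fixes M :: "'a::semiring_1^'n^'m"
  shows "(mat c ** M) $ i $ j = c * M $ i $ j"
  by (simp add: matrix_matrix_mult_def mat_def if_distrib[where f="\<lambda>x. x * _"] cong: if_cong)

lemma mult_mat_nth:
  fixes M :: "'a::semiring_1^'n^'m"
  shows "(M ** mat c) $ i $ j = M $ i $ j * c"
  by (simp add: matrix_matrix_mult_def mat_def if_distrib[where f="\<lambda>x. _ * x"] cong: if_cong)

lemma mat_commute:
  fixes M :: "'a::comm_semiring_1^'n^'n"
  shows "mat c ** M = M ** mat c"
  by (simp add: vec_eq_iff mat_mult_nth mult_mat_nth mult.commute)

lemma mat_mult_mat: "mat c ** mat d = (mat (c * d) :: 'a::semiring_1^'n^'n)"
  by (simp add: vec_eq_iff mat_mult_nth) (simp add: mat_def)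

lemma mat_vector_mult: "mat c *v x = c *s (x :: 'a::semiring_1^'n)"
  by (simp add: vec_eq_iff matrix_vector_mult_def mat_def if_distrib[where f="\<lambda>x. x * _"]
      cong: if_cong)

lemma matrix_power_commute:
  assumes "A ** P = P ** A"
  shows "matrix_power A k ** P = P ** matrix_power A k"
  by (induction k) (simp_all, metis assms matrix_mul_assoc)

text \<open>Finite sums of matrices in the commutant of \<open>A\<close> whose range lies in a single generalized
  eigenspace. An inductive set makes the index sets of such sums disappear: statements about the
  decomposition become inductions.\<close>

inductive_set spectral_matrices :: "complex^'n^'n \<Rightarrow> (complex^'n^'n) set" for A where
  gen: "A ** P = P ** A \<Longrightarrow> matrix_power (A - mat \<mu>) k ** P = 0 \<Longrightarrow> P \<in> spectral_matrices A"
| add: "P \<in> spectral_matrices A \<Longrightarrow> Q \<in> spectral_matrices A \<Longrightarrow> P + Q \<in> spectral_matrices A"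

lemma zero_spectral: "0 \<in> spectral_matrices A"
  by (rule spectral_matrices.gen[where k=0]) simp_all

lemma spectral_commute: "Q \<in> spectral_matrices A \<Longrightarrow> A ** Q = Q ** A"
  by (induction rule: spectral_matrices.induct) (simp_all add: matrix_add_ldistrib matrix_add_rdistrib)

lemma spectral_scale: "Q \<in> spectral_matrices A \<Longrightarrow> mat c ** Q \<in> spectral_matrices A"
proof (induction rule: spectral_matrices.induct)
  case (gen P \<mu> k)
  have "A ** (mat c ** P) = (mat c ** P) ** A"
    using gen(1) mat_commute[of c A] by (metis matrix_mul_assoc)
  moreover have "matrix_power (A - mat \<mu>) k ** (mat c ** P) = 0"
    using gen(2) mat_commute[of c P] by (metis matrix_mul_assoc times0_left)
  ultimately show ?case by (rule spectral_matrices.gen)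
qed (simp add: matrix_add_ldistrib spectral_matrices.add)

lemma shift_commute:
  fixes A :: "complex^'n^'n"
  assumes "A ** P = P ** A"
  shows "(A - mat \<mu>) ** P = P ** (A - mat \<mu>)"
  using assms mat_commute[of \<mu> P] by (simp add: matrix_diff_ldistrib matrix_diff_rdistrib)

text \<open>On the generalized eigenspace for \<open>\<nu>\<close>, the map \<open>A - \<mu> = (A - \<nu>) + (\<nu> - \<mu>)\<close> is a nonzero scalar
  plus a nilpotent one, hence invertible there. The induction on the order of nilpotency sums the
  geometric series for the inverse without writing it down.\<close>

lemma shift_invertible_on_other_eigenspace:
  fixes A :: "complex^'n^'n"
  assumes "\<nu> \<noteq> \<mu>" "A ** P = P ** A" "matrix_power (A - mat \<nu>) k ** P = 0"
  shows "\<exists>R. A ** R = R ** A \<and> matrix_power (A - mat \<nu>) k ** R = 0 \<and> (A - mat \<mu>) ** R = P"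
  using assms(2,3)
proof (induction k arbitrary: P)
  case 0
  then show ?case by (intro exI[of _ 0]) simp
next
  case (Suc k)
  let ?N = "A - mat \<nu>"
  have "A ** ?N = ?N ** A"
    using mat_commute[of \<nu> A] by (simp add: matrix_diff_ldistrib matrix_diff_rdistrib)
  then have "A ** (?N ** P) = (?N ** P) ** A"
    using Suc.prems(1) by (metis matrix_mul_assoc)
  moreover have "matrix_power ?N k ** (?N ** P) = 0"
    using Suc.prems(2) by (simp only: matrix_power_Suc_right matrix_mul_assoc)
  ultimately obtain R' where R': "A ** R' = R' ** A" "matrix_power ?N k ** R' = 0"
    "(A - mat \<mu>) ** R' = ?N ** P"
    using Suc.IH by blast
  let ?c = "inverse (\<nu> - \<mu>)"
  \<comment> \<open>the solution of \<open>(A - \<mu>) R = P\<close>: here \<open>(A - \<mu>) (P - R') = (\<nu> - \<mu>) P\<close>\<close>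
  define R where "R = mat ?c ** (P - R')"
  have "A ** R = R ** A"
    unfolding R_def using Suc.prems(1) R'(1) mat_commute[of ?c A]
    by (metis (no_types, opaque_lifting) matrix_mul_assoc matrix_diff_ldistrib matrix_diff_rdistrib)
  moreover have "matrix_power ?N (Suc k) ** R = 0"
  proof -
    have "matrix_power ?N (Suc k) ** R' = 0"
      using R'(2) by (simp add: matrix_mul_assoc[symmetric])
    then have "matrix_power ?N (Suc k) ** (P - R') = 0"
      using Suc.prems(2) by (simp add: matrix_diff_ldistrib)
    moreover have "matrix_power ?N (Suc k) ** R = mat ?c ** (matrix_power ?N (Suc k) ** (P - R'))"
      unfolding R_def matrix_mul_assoc mat_commute[of ?c "matrix_power ?N (Suc k)"] ..
    ultimately show ?thesis by simp
  qed
  moreover have "(A - mat \<mu>) ** R = P"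
  proof -
    have "(A - mat \<mu>) ** (P - R') = mat (\<nu> - \<mu>) ** P"
      unfolding matrix_diff_ldistrib R'(3)
      by (simp add: vec_eq_iff matrix_diff_rdistrib mat_mult_nth algebra_simps)
    moreover have "(A - mat \<mu>) ** R = mat ?c ** ((A - mat \<mu>) ** (P - R'))"
      unfolding R_def matrix_mul_assoc mat_commute[of ?c "A - mat \<mu>"] ..
    ultimately show ?thesis
      using \<open>\<nu> \<noteq> \<mu>\<close> by (simp add: matrix_mul_assoc mat_mult_mat)
  qed
  ultimately show ?case by blast
qed

lemma matrix_power_mult_zero_mono:
  fixes N :: "'a::semiring_1^'n^'n"
  assumes "matrix_power N k ** P = 0" "k \<le> l"
  shows "matrix_power N l ** P = 0"
  using assms(2) by (induction rule: dec_induct) (simp_all add: assms(1) matrix_mul_assoc[symmetric])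

text \<open>Division with remainder by \<open>A - \<mu>\<close>: the components for the other eigenvalues are divisible, since
  \<open>A - \<mu>\<close> is invertible there, and the component for \<open>\<mu>\<close> is the remainder.\<close>

lemma spectral_split:
  assumes "M \<in> spectral_matrices A"
  shows "\<exists>R\<in>spectral_matrices A. \<exists>P k. A ** P = P ** A \<and> matrix_power (A - mat \<mu>) k ** P = 0 \<and>
    M = (A - mat \<mu>) ** R + P"
  using assms
proof (induction rule: spectral_matrices.induct)
  case (gen P \<nu> k)
  show ?case
  proof (cases "\<nu> = \<mu>")
    case True
    then show ?thesis
      using gen zero_spectral by (intro bexI[of _ 0] exI[of _ P] exI[of _ k]) auto
  next
    case False
    then obtain R where R: "A ** R = R ** A" "matrix_power (A - mat \<nu>) k ** R = 0"
      "(A - mat \<mu>) ** R = P"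
      using shift_invertible_on_other_eigenspace gen by blast
    then have "R \<in> spectral_matrices A" by (blast intro: spectral_matrices.gen)
    then show ?thesis
      using R by (intro bexI[of _ R] exI[of _ 0] exI[of _ 0]) auto
  qed
next
  case (add M1 M2)
  then obtain R1 P1 k1 R2 P2 k2 where *:
    "R1 \<in> spectral_matrices A" "A ** P1 = P1 ** A" "matrix_power (A - mat \<mu>) k1 ** P1 = 0"
    "M1 = (A - mat \<mu>) ** R1 + P1"
    "R2 \<in> spectral_matrices A" "A ** P2 = P2 ** A" "matrix_power (A - mat \<mu>) k2 ** P2 = 0"
    "M2 = (A - mat \<mu>) ** R2 + P2"
    by blast
  have "matrix_power (A - mat \<mu>) (max k1 k2) ** (P1 + P2) = 0"
    using * by (simp add: matrix_add_ldistrib matrix_power_mult_zero_mono[where l="max k1 k2"])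
  moreover have "A ** (P1 + P2) = (P1 + P2) ** A"
    using * by (simp add: matrix_add_ldistrib matrix_add_rdistrib)
  moreover have "M1 + M2 = (A - mat \<mu>) ** (R1 + R2) + (P1 + P2)"
    using * by (simp add: matrix_add_ldistrib algebra_simps)
  ultimately show ?case
    using * spectral_matrices.add by blast
qed

text \<open>If \<open>(A - \<mu>) Q = (A - \<mu>) R + P\<close> with \<open>P\<close> living on the eigenspace for \<open>\<mu>\<close>, then \<open>Q - R\<close> also lives on
  that eigenspace, with the order of nilpotency raised by one. So linear factors can be cancelled one
  at a time, which replaces the usual argument with coprime polynomials.\<close>

lemma spectral_cancel_factor:
  assumes Q: "A ** Q = Q ** A" and M: "(A - mat \<mu>) ** Q \<in> spectral_matrices A"
  shows "Q \<in> spectral_matrices A"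
proof -
  obtain R P k where R: "R \<in> spectral_matrices A"
    and P: "matrix_power (A - mat \<mu>) k ** P = 0" "(A - mat \<mu>) ** Q = (A - mat \<mu>) ** R + P"
    using spectral_split[OF M] by blast
  have "matrix_power (A - mat \<mu>) (Suc k) ** (Q - R) = 0"
    unfolding matrix_power_Suc_right matrix_mul_assoc[symmetric] matrix_diff_ldistrib[of _ Q R]
    using P by (simp add: matrix_add_ldistrib)
  moreover have "A ** (Q - R) = (Q - R) ** A"
    using Q spectral_commute[OF R] by (simp add: matrix_diff_ldistrib matrix_diff_rdistrib)
  ultimately have "Q - R \<in> spectral_matrices A"
    by (rule spectral_matrices.gen[rotated])
  from spectral_matrices.add[OF R this] show ?thesis by simp
qed

definition poly_matrix :: "complex poly \<Rightarrow> complex^'n^'n \<Rightarrow> complex^'n^'n" where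
  "poly_matrix p A = (\<Sum>i\<le>degree p. mat (coeff p i) ** matrix_power A i)"

lemma poly_matrix_bound:
  assumes "degree p \<le> n"
  shows "poly_matrix p A = (\<Sum>i\<le>n. mat (coeff p i) ** matrix_power A i)"
  unfolding poly_matrix_def
  by (rule sum.mono_neutral_left) (use assms in \<open>auto simp: coeff_eq_0\<close>)

lemma poly_matrix_commute: "A ** poly_matrix p A = poly_matrix p A ** A"
proof -
  have comm: "A ** (mat c ** matrix_power A i) = (mat c ** matrix_power A i) ** A" for c i
    using mat_commute[of c A] matrix_power_commute[OF refl, of A i] by (metis matrix_mul_assoc)
  show ?thesis
    unfolding poly_matrix_def matrix_sum_ldistrib matrix_sum_rdistrib comm ..
qed

lemma poly_matrix_linear_factor: "poly_matrix ([:- \<mu>, 1:] * q) A = (A - mat \<mu>) ** poly_matrix q A"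
proof -
  let ?n = "degree q"
  let ?c = "\<lambda>p i. mat (coeff p i) ** matrix_power A i"
  have "degree ([:- \<mu>, 1:] * q) \<le> Suc ?n"
    using degree_mult_le[of "[:- \<mu>, 1:]" q] by simp
  then have "poly_matrix ([:- \<mu>, 1:] * q) A = (\<Sum>i\<le>Suc ?n. ?c ([:- \<mu>, 1:] * q) i)"
    by (rule poly_matrix_bound)
  also have "\<dots> = (\<Sum>i\<le>Suc ?n. ?c (pCons 0 q) i - mat \<mu> ** ?c q i)"
    by (intro sum.cong refl) (simp add: vec_eq_iff mat_mult_nth algebra_simps)
  also have "\<dots> = (\<Sum>i\<le>Suc ?n. ?c (pCons 0 q) i) - mat \<mu> ** (\<Sum>i\<le>Suc ?n. ?c q i)"
    unfolding sum_subtractf matrix_sum_ldistrib ..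
  also have "(\<Sum>i\<le>Suc ?n. ?c q i) = poly_matrix q A"
    by (rule poly_matrix_bound[symmetric]) simp
  also have "(\<Sum>i\<le>Suc ?n. ?c (pCons 0 q) i) = A ** poly_matrix q A"
    unfolding sum.atMost_Suc_shift poly_matrix_def matrix_sum_ldistrib
    by (simp add: matrix_mul_assoc) (simp only: mat_commute[of _ A])
  finally show ?thesis by (simp add: matrix_diff_rdistrib)
qed

lemma sequence_linearly_dependent:
  fixes f :: "nat \<Rightarrow> 'v::euclidean_space"
  shows "\<exists>J c. finite J \<and> (\<exists>j\<in>J. c j \<noteq> 0) \<and> (\<Sum>j\<in>J. c j *\<^sub>R f j) = 0"
proof (cases "inj f")
  case True
  then have "infinite (range f)" by (simp add: finite_image_iff)
  then have "dependent (range f)" using independent_imp_finite by blast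
  then obtain T u where T: "finite T" "T \<subseteq> range f" "\<exists>v\<in>T. u v \<noteq> 0" "(\<Sum>v\<in>T. u v *\<^sub>R v) = 0"
    unfolding dependent_explicit by auto
  have "T = f ` (f -` T)" using T(2) by auto
  then have "(\<Sum>j\<in>f -` T. u (f j) *\<^sub>R f j) = 0"
    using T(4) sum.reindex[OF inj_on_subset[OF True subset_UNIV], of "\<lambda>v. u v *\<^sub>R v" "f -` T"]
    by simp
  moreover have "finite (f -` T)" using True T(1) by (simp add: finite_vimageI)
  moreover have "\<exists>j\<in>f -` T. u (f j) \<noteq> 0" using T(2,3) by (metis imageE subsetD vimageI)
  ultimately show ?thesis
    by (intro exI[of _ "f -` T"] exI[of _ "\<lambda>j. u (f j)"] conjI)
next
  case False
  then obtain i j where "i \<noteq> j" "f i = f j" by (auto simp: inj_def)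
  then show ?thesis
    by (intro exI[of _ "{i, j}"] exI[of _ "\<lambda>l. if l = i then 1 else - 1"]) auto
qed

text \<open>The powers of \<open>A\<close> are linearly dependent over \<open>\<real>\<close> already, since the space of matrices has finite
  real dimension.\<close>

lemma annihilating_polynomial:
  fixes A :: "complex^'n^'n"
  shows "\<exists>p. p \<noteq> 0 \<and> poly_matrix p A = 0"
proof -
  obtain J and c :: "nat \<Rightarrow> real" and j where J: "finite J" "j \<in> J" "c j \<noteq> 0"
    and zero: "(\<Sum>j\<in>J. c j *\<^sub>R matrix_power A j) = 0"
    using sequence_linearly_dependent[of "matrix_power A"] by blast
  define p where "p = (\<Sum>j\<in>J. monom (complex_of_real (c j)) j)"
  have coeff: "coeff p i = (if i \<in> J then of_real (c i) else 0)" for i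
    using J(1) by (simp add: p_def coeff_sum if_distrib cong: if_cong)
  then have "p \<noteq> 0" using J(2,3) by (metis coeff_0 of_real_eq_0_iff)
  define n where "n = Max (J \<union> {degree p})"
  have n: "degree p \<le> n" "J \<subseteq> {..n}" using J(1) by (auto simp: n_def)
  have "poly_matrix p A = (\<Sum>i\<le>n. mat (coeff p i) ** matrix_power A i)"
    by (rule poly_matrix_bound[OF n(1)])
  also have "\<dots> = (\<Sum>i\<in>J. mat (coeff p i) ** matrix_power A i)"
    by (rule sum.mono_neutral_right) (use n coeff in auto)
  also have "\<dots> = (\<Sum>i\<in>J. c i *\<^sub>R matrix_power A i)"
    unfolding coeff by (intro sum.cong refl) (simp add: vec_eq_iff mat_mult_nth scaleR_conv_of_real[where 'a=complex])
  finally show ?thesis using zero \<open>p \<noteq> 0\<close> by auto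
qed

text \<open>The fundamental theorem of algebra splits a linear factor off \<open>p\<close>, and that factor can be cancelled.\<close>

lemma spectral_if_poly_matrix_zero:
  assumes "p \<noteq> 0" "poly_matrix p A ** Q \<in> spectral_matrices A" "A ** Q = Q ** A"
  shows "Q \<in> spectral_matrices A"
  using assms(1,2)
proof (induction "degree p" arbitrary: p)
  case 0
  obtain c where c: "p = [:c:]"
    using degree_eq_zeroE[of p] 0(1)[symmetric] by blast
  have "c \<noteq> 0" using 0(2) c by simp
  have "mat c ** Q \<in> spectral_matrices A"
    using 0(3) by (simp add: c poly_matrix_def)
  from spectral_scale[OF this, of "inverse c"] show ?case
    using \<open>c \<noteq> 0\<close> by (simp add: matrix_mul_assoc mat_mult_mat)
next
  case (Suc n)
  have "\<not> constant (poly p)"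
    using Suc.hyps(2) constant_degree[of p] by simp
  then obtain \<mu> where "poly p \<mu> = 0"
    using fundamental_theorem_of_algebra by blast
  then obtain q where q: "p = [:- \<mu>, 1:] * q"
    unfolding poly_eq_0_iff_dvd by (elim dvdE)
  then have "q \<noteq> 0" using Suc.prems(1) by (intro notI) simp
  then have "degree p = Suc (degree q)"
    unfolding q by (subst degree_mult_eq) simp_all
  then have "degree q = n"
    using Suc.hyps(2) by simp
  have "A ** (poly_matrix q A ** Q) = (poly_matrix q A ** Q) ** A"
    using poly_matrix_commute[of A q] assms(3) by (metis matrix_mul_assoc)
  moreover have "(A - mat \<mu>) ** (poly_matrix q A ** Q) \<in> spectral_matrices A"
    using Suc.prems(2) unfolding q poly_matrix_linear_factor matrix_mul_assoc .
  ultimately have "poly_matrix q A ** Q \<in> spectral_matrices A"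
    by (rule spectral_cancel_factor)
  with Suc.hyps(1)[OF \<open>degree q = n\<close>[symmetric] \<open>q \<noteq> 0\<close>] show ?case .
qed

lemma one_spectral: "mat 1 \<in> spectral_matrices A"
proof -
  obtain p where "p \<noteq> 0" "poly_matrix p A = 0"
    using annihilating_polynomial by blast
  then show ?thesis
    using spectral_if_poly_matrix_zero[of p A "mat 1"] by (simp add: zero_spectral)
qed

section \<open>The flow on a generalized eigenspace\<close>

text \<open>The exponential series of \<open>t N\<close>, cut off at a degree from which on it vanishes on the kernel of
  \<open>N\<^sup>k\<close>.\<close>

definition nilpotent_exp :: "complex^'n^'n \<Rightarrow> nat \<Rightarrow> real \<Rightarrow> complex^'n \<Rightarrow> complex^'n" where
  "nilpotent_exp N k t v = (\<Sum>j<k. (t ^ j / fact j) *\<^sub>R (matrix_power N j *v v))"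

lemma matrix_power_kernel_mono:
  assumes "matrix_power N k *v v = 0" "k \<le> l"
  shows "matrix_power N l *v v = 0"
  using assms(2)
  by (induction rule: dec_induct) (simp_all add: assms(1) matrix_vector_mul_assoc[symmetric])

lemma matrix_power_add: "matrix_power N (i + j) = matrix_power N i ** matrix_power N j"
  by (induction i) (simp_all add: matrix_mul_assoc)

text \<open>The binomial theorem for \<open>A = \<mu> + (A - \<mu>)\<close>; the nilpotent part cuts the sum off at \<open>k\<close>, uniformly
  in \<open>m\<close>, which makes the termwise summation of the exponential series a finite one.\<close>

lemma matrix_power_binomial:
  fixes A :: "complex^'n^'n"
  assumes nil: "matrix_power (A - mat \<mu>) k *v v = 0"
  shows "matrix_power A m *v v =
    (\<Sum>j<k. (of_nat (m choose j) * \<mu> ^ (m - j)) *s (matrix_power (A - mat \<mu>) j *v v))"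
proof (induction m)
  case 0
  have "(\<Sum>j<k. (of_nat (0 choose j) * \<mu> ^ (0 - j)) *s (matrix_power (A - mat \<mu>) j *v v))
      = (\<Sum>j<k. if j = 0 then v else 0)"
    by (intro sum.cong refl) (auto simp: binomial_eq_0)
  also have "\<dots> = v"
    using nil by (cases "k = 0") simp_all
  finally show ?case by simp
next
  case (Suc m)
  let ?w = "\<lambda>j. matrix_power (A - mat \<mu>) j *v v"
  let ?c = "\<lambda>m j. of_nat (m choose j) * \<mu> ^ (m - j) :: complex"
  let ?g = "\<lambda>j. if j = 0 then 0 else ?c m (j - 1)"
  have A: "A *v ?w j = \<mu> *s ?w j + ?w (Suc j)" for j
    by (simp add: matrix_vector_mul_assoc[symmetric] matrix_vector_mult_diff_rdistrib mat_vector_mult)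
  have pascal: "?c (Suc m) j = \<mu> * ?c m j + ?g j" for j
  proof (cases j)
    case (Suc i)
    show ?thesis
    proof (cases "j \<le> m")
      case True
      then have "m - i = Suc (m - j)" using Suc by simp
      then show ?thesis using Suc by (simp add: algebra_simps)
    qed (use Suc in \<open>simp add: binomial_eq_0\<close>)
  qed simp
  have "matrix_power A (Suc m) *v v = A *v (\<Sum>j<k. ?c m j *s ?w j)"
    using Suc.IH by (simp add: matrix_vector_mul_assoc[symmetric])
  also have "\<dots> = (\<Sum>j<k. (\<mu> * ?c m j) *s ?w j) + (\<Sum>j<k. ?c m j *s ?w (Suc j))"
    unfolding vec.sum vec.scale A
    by (simp add: sum.distrib[symmetric] vector_add_ldistrib vector_smult_assoc mult_ac)
  also have "(\<Sum>j<k. ?c m j *s ?w (Suc j)) = (\<Sum>j<Suc k. ?g j *s ?w j)"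
    unfolding sum.lessThan_Suc_shift by simp
  also have "\<dots> = (\<Sum>j<k. ?g j *s ?w j)"
    using nil by simp
  finally show ?case
    unfolding pascal by (simp add: sum.distrib[symmetric] vec.scale_left_distrib)
qed

lemma binomial_exp_sums:
  fixes \<mu> :: complex
  shows "(\<lambda>m. of_real (t ^ m / fact m) * (of_nat (m choose j) * \<mu> ^ (m - j)))
    sums (exp (of_real t * \<mu>) * of_real (t ^ j / fact j))"
proof -
  let ?f = "\<lambda>m. of_real (t ^ m / fact m) * (of_nat (m choose j) * \<mu> ^ (m - j))"
  have "?f (i + j) = (of_real t * \<mu>) ^ i /\<^sub>R fact i * of_real (t ^ j / fact j)" for i
  proof -
    have "(of_nat ((i + j) choose j) :: complex) = fact (i + j) / (fact j * fact i)"
      using binomial_fact[of j "i + j", where 'a=complex] by simp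
    then show ?thesis
      by (simp add: scaleR_conv_of_real power_add power_mult_distrib field_simps)
  qed
  moreover have "(\<lambda>i. (of_real t * \<mu>) ^ i /\<^sub>R fact i * of_real (t ^ j / fact j))
      sums (exp (of_real t * \<mu>) * of_real (t ^ j / fact j))"
    by (rule sums_mult2) (rule exp_converges)
  ultimately have "(\<lambda>i. ?f (i + j)) sums (exp (of_real t * \<mu>) * of_real (t ^ j / fact j))"
    by simp
  then show ?thesis
    by (subst (asm) sums_zero_iff_shift) (auto simp: binomial_eq_0)
qed

text \<open>Weighted by \<open>t\<^sup>m / m!\<close>, each of the \<open>k\<close> coefficient sequences from the binomial theorem sums to
  \<open>e\<^sup>\<mu>\<^sup>t t\<^sup>j / j!\<close>.\<close>

lemma linear_flow_gen_eigenvector: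
  fixes A :: "complex^'n^'n"
  assumes "matrix_power (A - mat \<mu>) k *v v = 0"
  shows "linear_flow A t v = exp (of_real t * \<mu>) *s nilpotent_exp (A - mat \<mu>) k t v"
proof -
  let ?w = "\<lambda>j. matrix_power (A - mat \<mu>) j *v v"
  let ?c = "\<lambda>m j. of_nat (m choose j) * \<mu> ^ (m - j) :: complex"
  have "bounded_linear (\<lambda>c. c *s w)" for w :: "complex^'n"
    unfolding linear_conv_bounded_linear[symmetric]
    by (intro linearI) (simp_all add: vec_eq_iff algebra_simps)
  then have "(\<lambda>m. \<Sum>j<k. (of_real (t ^ m / fact m) * ?c m j) *s ?w j)
      sums (\<Sum>j<k. (exp (of_real t * \<mu>) * of_real (t ^ j / fact j)) *s ?w j)"
    by (intro sums_sum bounded_linear.sums[where f="\<lambda>c. c *s _"] binomial_exp_sums)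
  moreover have "(\<Sum>j<k. (of_real (t ^ m / fact m) * ?c m j) *s ?w j)
      = (t ^ m / fact m) *\<^sub>R (matrix_power A m *v v)" for m
    unfolding matrix_power_binomial[OF assms] scaleR_eq_vector_mult vec.scale_sum_right
    by (simp add: vector_smult_assoc)
  moreover have "(\<Sum>j<k. (exp (of_real t * \<mu>) * of_real (t ^ j / fact j)) *s ?w j)
      = exp (of_real t * \<mu>) *s nilpotent_exp (A - mat \<mu>) k t v"
    unfolding nilpotent_exp_def scaleR_eq_vector_mult vec.scale_sum_right
    by (simp add: vector_smult_assoc)
  ultimately show ?thesis
    using linear_flow_sums[of t A v] sums_unique2 by fastforce
qed

text \<open>The product of the two truncated series is regrouped by total degree. Degrees from \<open>k\<close> on vanish
  by nilpotency, and degree \<open>m < k\<close> has the coefficient \<open>(- t + t)\<^sup>m / m!\<close>.\<close>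

lemma nilpotent_exp_inverse:
  fixes N :: "complex^'n^'n"
  assumes nil: "matrix_power N k *v v = 0"
  shows "nilpotent_exp N k (- t) (nilpotent_exp N k t v) = v"
proof -
  let ?w = "\<lambda>j. matrix_power N j *v v"
  let ?h = "\<lambda>i j. ((- t) ^ i / fact i * (t ^ j / fact j)) *\<^sub>R ?w (i + j)"
  have "nilpotent_exp N k (- t) (nilpotent_exp N k t v) = (\<Sum>i<k. \<Sum>j<k. ?h i j)"
    unfolding nilpotent_exp_def vec.sum
    by (simp add: scaleR_sum_right linear_scale[OF bounded_linear.linear[OF matrix_vector_mul_bounded_linear]]
      matrix_vector_mul_assoc matrix_power_add)
  also have "\<dots> = (\<Sum>(i, j)\<in>{..<k} \<times> {..<k}. ?h i j)"
    by (rule sum.cartesian_product)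
  also have "\<dots> = (\<Sum>(i, j)\<in>{(i, j). i + j < k}. ?h i j)"
  proof (rule sum.mono_neutral_right)
    show "\<forall>p\<in>{..<k} \<times> {..<k} - {(i, j). i + j < k}. (case p of (i, j) \<Rightarrow> ?h i j) = 0"
      using matrix_power_kernel_mono[OF nil] by (auto simp: not_less) (meson not_le_imp_less)
  qed auto
  also have "\<dots> = (\<Sum>m<k. \<Sum>i\<le>m. ?h i (m - i))"
    by (rule sum.triangle_reindex)
  also have "\<dots> = (\<Sum>m<k. (if m = 0 then v else 0))"
  proof (rule sum.cong[OF refl])
    fix m
    have "(\<Sum>i\<le>m. ?h i (m - i)) = (\<Sum>i\<le>m. (- t) ^ i / fact i * (t ^ (m - i) / fact (m - i))) *\<^sub>R ?w m"
      by (simp add: scaleR_sum_left)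
    also have "(\<Sum>i\<le>m. (- t) ^ i / fact i * (t ^ (m - i) / fact (m - i))) = (- t + t) ^ m / fact m"
      using exp_series_add_commuting[of "- t" t m] by (simp add: field_simps)
    finally show "(\<Sum>i\<le>m. ?h i (m - i)) = (if m = 0 then v else 0)"
      by (simp add: power_0_left)
  qed
  also have "\<dots> = v"
    using nil by (cases "k = 0") simp_all
  finally show ?thesis .
qed

lemma nilpotent_exp_bound:
  "\<exists>C. \<forall>t v. norm (nilpotent_exp N k t v) \<le> (\<Sum>j<k. C j * \<bar>t\<bar> ^ j) * norm v"
proof -
  define C where "C j = onorm ((*v) (matrix_power N j))" for j
  have "norm (nilpotent_exp N k t v) \<le> (\<Sum>j<k. C j * \<bar>t\<bar> ^ j) * norm v" for t v
  proof -
    have "norm (nilpotent_exp N k t v) \<le> (\<Sum>j<k. norm ((t ^ j / fact j) *\<^sub>R (matrix_power N j *v v)))"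
      unfolding nilpotent_exp_def by (rule norm_sum)
    also have "\<dots> \<le> (\<Sum>j<k. \<bar>t\<bar> ^ j * (C j * norm v))"
    proof (rule sum_mono)
      fix j
      have "norm (matrix_power N j *v v) \<le> C j * norm v"
        unfolding C_def by (intro onorm matrix_vector_mul_bounded_linear)
      moreover have "\<bar>t ^ j / fact j\<bar> \<le> \<bar>t\<bar> ^ j"
        by (simp add: power_abs divide_le_eq mult_le_cancel_left1 fact_ge_1)
      ultimately show "norm ((t ^ j / fact j) *\<^sub>R (matrix_power N j *v v)) \<le> \<bar>t\<bar> ^ j * (C j * norm v)"
        unfolding norm_scaleR by (intro mult_mono) auto
    qed
    also have "\<dots> = (\<Sum>j<k. C j * \<bar>t\<bar> ^ j) * norm v"
      unfolding sum_distrib_right by (simp only: mult_ac)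
    finally show ?thesis .
  qed
  then show ?thesis by blast
qed

lemma exp_dominates_polynomial:
  fixes C :: "nat \<Rightarrow> real"
  assumes "a > 0"
  shows "\<exists>T0. \<forall>t\<ge>T0. exp (- a * t) * (\<Sum>j<k. C j * \<bar>t\<bar> ^ j) \<le> 1 / 2"
proof -
  have "((\<lambda>t. exp (- a * t) * (C j * t ^ j)) \<longlongrightarrow> 0) at_top" for j
  proof -
    have "filterlim (\<lambda>t. a * t) at_top at_top"
      using assms by (intro filterlim_tendsto_pos_mult_at_top[OF tendsto_const]) (auto simp: filterlim_ident)
    from filterlim_compose[OF tendsto_power_div_exp_0 this]
    have "((\<lambda>t. C j / a ^ j * ((a * t) ^ j / exp (a * t))) \<longlongrightarrow> C j / a ^ j * 0) at_top"
      by (intro tendsto_intros)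
    moreover have "C j / a ^ j * ((a * t) ^ j / exp (a * t)) = exp (- a * t) * (C j * t ^ j)" for t
      using assms by (simp add: power_mult_distrib exp_minus field_simps)
    ultimately show ?thesis by simp
  qed
  then have "((\<lambda>t. \<Sum>j<k. exp (- a * t) * (C j * t ^ j)) \<longlongrightarrow> (\<Sum>j<k. 0)) at_top"
    by (intro tendsto_sum)
  then have "\<forall>\<^sub>F t in at_top. (\<Sum>j<k. exp (- a * t) * (C j * t ^ j)) < 1 / 2"
    by (intro order_tendstoD(2)) auto
  then obtain T where T: "\<And>t. t \<ge> T \<Longrightarrow> (\<Sum>j<k. exp (- a * t) * (C j * t ^ j)) < 1 / 2"
    unfolding eventually_at_top_linorder by blast
  have "exp (- a * t) * (\<Sum>j<k. C j * \<bar>t\<bar> ^ j) \<le> 1 / 2" if "t \<ge> max T 0" for t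
    using T[of t] that by (simp add: sum_distrib_left)
  then show ?thesis by blast
qed

lemma gen_eigenspace_contracting:
  fixes A :: "complex^'n^'n"
  assumes "Re \<mu> < 0"
  shows "\<exists>T0. \<forall>t\<ge>T0. \<forall>v. matrix_power (A - mat \<mu>) k *v v = 0 \<longrightarrow>
    norm (linear_flow A t v) \<le> norm v / 2"
proof -
  obtain C where C: "\<And>t v. norm (nilpotent_exp (A - mat \<mu>) k t v) \<le> (\<Sum>j<k. C j * \<bar>t\<bar> ^ j) * norm v"
    using nilpotent_exp_bound by blast
  obtain T0 where T0: "\<And>t. t \<ge> T0 \<Longrightarrow> exp (- (- Re \<mu>) * t) * (\<Sum>j<k. C j * \<bar>t\<bar> ^ j) \<le> 1 / 2"
    using exp_dominates_polynomial[of "- Re \<mu>" C k] assms by auto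
  have "norm (linear_flow A t v) \<le> norm v / 2"
    if "t \<ge> T0" and v: "matrix_power (A - mat \<mu>) k *v v = 0" for t v
  proof -
    have "norm (linear_flow A t v) = exp (Re \<mu> * t) * norm (nilpotent_exp (A - mat \<mu>) k t v)"
      unfolding linear_flow_gen_eigenvector[OF v] norm_vector_mult by (simp add: mult.commute)
    also have "\<dots> \<le> exp (Re \<mu> * t) * ((\<Sum>j<k. C j * \<bar>t\<bar> ^ j) * norm v)"
      using C by (intro mult_left_mono) auto
    also have "\<dots> \<le> 1 / 2 * norm v"
      unfolding mult.assoc[symmetric] using T0[OF \<open>t \<ge> T0\<close>] by (intro mult_right_mono) auto
    finally show ?thesis by simp
  qed
  then show ?thesis by blast
qed

text \<open>The inverse of the truncated exponential has the same polynomial growth, so it turns an upper bound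
  into the lower bound needed here.\<close>

lemma gen_eigenspace_expanding:
  fixes A :: "complex^'n^'n"
  assumes "Re \<mu> > 0"
  shows "\<exists>T0. \<forall>t\<ge>T0. \<forall>v. matrix_power (A - mat \<mu>) k *v v = 0 \<longrightarrow>
    2 * norm v \<le> norm (linear_flow A t v)"
proof -
  obtain C where C: "\<And>t v. norm (nilpotent_exp (A - mat \<mu>) k t v) \<le> (\<Sum>j<k. C j * \<bar>t\<bar> ^ j) * norm v"
    using nilpotent_exp_bound by blast
  obtain T0 where T0: "\<And>t. t \<ge> T0 \<Longrightarrow> exp (- Re \<mu> * t) * (\<Sum>j<k. C j * \<bar>t\<bar> ^ j) \<le> 1 / 2"
    using exp_dominates_polynomial[of "Re \<mu>" C k] assms by auto
  have "2 * norm v \<le> norm (linear_flow A t v)"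
    if "t \<ge> T0" and v: "matrix_power (A - mat \<mu>) k *v v = 0" for t v
  proof -
    let ?u = "nilpotent_exp (A - mat \<mu>) k t v"
    have u: "norm ?u = exp (- Re \<mu> * t) * norm (linear_flow A t v)"
      unfolding linear_flow_gen_eigenvector[OF v] norm_vector_mult
      by (simp add: mult.commute mult.assoc[symmetric] exp_minus)
    have "norm v = norm (nilpotent_exp (A - mat \<mu>) k (- t) ?u)"
      by (simp add: nilpotent_exp_inverse[OF v])
    also have "\<dots> \<le> (\<Sum>j<k. C j * \<bar>t\<bar> ^ j) * norm ?u"
      using C[of "- t" ?u] by simp
    also have "\<dots> = (exp (- Re \<mu> * t) * (\<Sum>j<k. C j * \<bar>t\<bar> ^ j)) * norm (linear_flow A t v)"
      unfolding u by (simp only: mult_ac)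
    also have "\<dots> \<le> 1 / 2 * norm (linear_flow A t v)"
      using T0[OF \<open>t \<ge> T0\<close>] by (intro mult_right_mono) auto
    finally show ?thesis by simp
  qed
  then show ?thesis by blast
qed

section \<open>Chain recurrent points lie in the center space\<close>

text \<open>Above \<open>2 \<delta>\<close> the first recursion strictly decreases and the second one strictly increases, so
  neither could return to the start.\<close>

lemma cyclic_sequence_bound:
  fixes u :: "nat \<Rightarrow> real"
  assumes "k \<ge> 1" "u k = u 0" "\<delta> > 0"
    and "(\<forall>i<k. u (Suc i) \<le> u i / 2 + \<delta>) \<or> (\<forall>i<k. 2 * u i - \<delta> \<le> u (Suc i))"
  shows "u 0 \<le> 2 * \<delta>"
proof (rule ccontr)
  assume big: "\<not> u 0 \<le> 2 * \<delta>"
  obtain m where m: "k = Suc m" using assms(1) by (cases k) auto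
  from assms(4) show False
  proof
    assume *: "\<forall>i<k. u (Suc i) \<le> u i / 2 + \<delta>"
    have "i < k \<Longrightarrow> u (Suc i) < u 0" for i
    proof (induction i)
      case 0
      then show ?case using *[rule_format, of 0] big by auto
    next
      case (Suc i)
      then show ?case using *[rule_format, of "Suc i"] big by auto
    qed
    from this[of m] show False using assms(2) m by simp
  next
    assume *: "\<forall>i<k. 2 * u i - \<delta> \<le> u (Suc i)"
    have "i < k \<Longrightarrow> u (Suc i) > u 0" for i
    proof (induction i)
      case 0
      then show ?case using *[rule_format, of 0] big \<open>\<delta> > 0\<close> by auto
    next
      case (Suc i)
      then show ?case using *[rule_format, of "Suc i"] big \<open>\<delta> > 0\<close> by auto
    qed
    from this[of m] show False using assms(2) m by simp
  qed
qed

text \<open>\<open>P\<close> maps a closed chain through \<open>x\<close> to a closed chain through \<open>P x\<close> inside the range of \<open>P\<close>, and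
  the norms along that chain obey one of the two recursions.\<close>

lemma hyperbolic_projection_zero:
  fixes A P :: "complex^'n^'n"
  assumes x: "x \<in> chain_recurrent_set norm (linear_flow A)" and comm: "A ** P = P ** A"
    and hyp: "(\<forall>t\<ge>T0. \<forall>v. norm (linear_flow A t (P *v v)) \<le> norm (P *v v) / 2) \<or>
      (\<forall>t\<ge>T0. \<forall>v. 2 * norm (P *v v) \<le> norm (linear_flow A t (P *v v)))"
  shows "P *v x = 0"
proof -
  have "norm (P *v x) \<le> 2 * \<delta>" if "\<delta> > 0" for \<delta>
  proof -
    obtain C where "C > 0" and C: "\<And>v. norm (P *v v) \<le> norm v * C"
      using bounded_linear.pos_bounded[OF matrix_vector_mul_bounded_linear[of P]] by blast
    \<comment> \<open>\<open>T0\<close> need not be positive, but chain recurrence speaks of positive minimal times\<close>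
    have "is_chain norm (linear_flow A) (\<delta> / C) (max T0 1) x x"
      using x \<open>C > 0\<close> \<open>\<delta> > 0\<close> by (simp add: chain_recurrent_set_def)
    then obtain k \<tau> \<xi> where k: "k \<ge> 1" and ends: "\<xi> 0 = x" "\<xi> k = x"
      and step: "\<And>i. i < k \<Longrightarrow> \<tau> i \<ge> max T0 1"
        "\<And>i. i < k \<Longrightarrow> norm (linear_flow A (\<tau> i) (\<xi> i) - \<xi> (Suc i)) < \<delta> / C"
      unfolding is_chain_def by blast
    have jump: "norm (linear_flow A (\<tau> i) (P *v \<xi> i) - P *v \<xi> (Suc i)) < \<delta>" if "i < k" for i
    proof -
      have "norm (P *v (linear_flow A (\<tau> i) (\<xi> i) - \<xi> (Suc i)))
          \<le> norm (linear_flow A (\<tau> i) (\<xi> i) - \<xi> (Suc i)) * C"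
        by (rule C)
      also have "\<dots> < \<delta> / C * C"
        using step(2)[OF that] \<open>C > 0\<close> by (intro mult_strict_right_mono)
      finally show ?thesis
        using \<open>C > 0\<close> by (simp add: vec.diff linear_flow_commutes[OF comm[symmetric]])
    qed
    have "(\<forall>i<k. norm (P *v \<xi> (Suc i)) \<le> norm (P *v \<xi> i) / 2 + \<delta>) \<or>
        (\<forall>i<k. 2 * norm (P *v \<xi> i) - \<delta> \<le> norm (P *v \<xi> (Suc i)))"
      using hyp
    proof (elim disj_forward)
      assume *: "\<forall>t\<ge>T0. \<forall>v. norm (linear_flow A t (P *v v)) \<le> norm (P *v v) / 2"
      show "\<forall>i<k. norm (P *v \<xi> (Suc i)) \<le> norm (P *v \<xi> i) / 2 + \<delta>"
      proof (intro allI impI)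
        fix i assume i: "i < k"
        have "norm (linear_flow A (\<tau> i) (P *v \<xi> i)) \<le> norm (P *v \<xi> i) / 2"
          using * step(1)[OF i] by simp
        then show "norm (P *v \<xi> (Suc i)) \<le> norm (P *v \<xi> i) / 2 + \<delta>"
          using jump[OF i] norm_triangle_ineq2[of "P *v \<xi> (Suc i)" "linear_flow A (\<tau> i) (P *v \<xi> i)"]
          by (simp add: norm_minus_commute)
      qed
    next
      assume *: "\<forall>t\<ge>T0. \<forall>v. 2 * norm (P *v v) \<le> norm (linear_flow A t (P *v v))"
      show "\<forall>i<k. 2 * norm (P *v \<xi> i) - \<delta> \<le> norm (P *v \<xi> (Suc i))"
      proof (intro allI impI)
        fix i assume i: "i < k"
        have "2 * norm (P *v \<xi> i) \<le> norm (linear_flow A (\<tau> i) (P *v \<xi> i))"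
          using * step(1)[OF i] by simp
        then show "2 * norm (P *v \<xi> i) - \<delta> \<le> norm (P *v \<xi> (Suc i))"
          using jump[OF i] norm_triangle_ineq2[of "linear_flow A (\<tau> i) (P *v \<xi> i)" "P *v \<xi> (Suc i)"]
          by simp
      qed
    qed
    from cyclic_sequence_bound[of k "\<lambda>i. norm (P *v \<xi> i)" \<delta>, OF k _ \<open>\<delta> > 0\<close> this]
    show ?thesis by (simp add: ends)
  qed
  from this[of "norm (P *v x) / 4"] show ?thesis
    by (cases "P *v x = 0") auto
qed

text \<open>The last nonzero vector among \<open>v\<close>, \<open>(A - \<mu>) v\<close>, \<open>(A - \<mu>)\<^sup>2 v\<close>, \<open>\<dots>\<close> is an eigenvector.\<close>

lemma eigenvalue_if_gen_eigenvector:
  assumes "v \<in> gen_eigenspace A \<mu>" "v \<noteq> 0"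
  shows "eigenvalue A \<mu>"
proof -
  obtain k where "matrix_power (A - mat \<mu>) k *v v = 0"
    using assms(1) by (auto simp: gen_eigenspace_def)
  then show ?thesis
  proof (induction k)
    case 0
    then show ?case using assms(2) by simp
  next
    case (Suc k)
    let ?u = "matrix_power (A - mat \<mu>) k *v v"
    show ?case
    proof (cases "?u = 0")
      case False
      moreover have "A *v ?u = \<mu> *s ?u"
        using Suc.prems by (simp add: matrix_vector_mul_assoc[symmetric]
            matrix_vector_mult_diff_rdistrib mat_vector_mult)
      ultimately show ?thesis unfolding eigenvalue_def by blast
    qed (rule Suc.IH)
  qed
qed

lemma chain_recurrent_spectral_component:
  fixes A :: "complex^'n^'n"
  assumes "Q \<in> spectral_matrices A" and x: "x \<in> chain_recurrent_set norm (linear_flow A)"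
  shows "Q *v x \<in> center_space_complex A"
  using assms(1)
proof (induction rule: spectral_matrices.induct)
  case (gen P \<mu> k)
  have ker: "matrix_power (A - mat \<mu>) k *v (P *v v) = 0" for v
    by (simp add: matrix_vector_mul_assoc gen(2))
  have "P *v x = 0" if "Re \<mu> \<noteq> 0"
  proof (cases "Re \<mu> < 0")
    case True
    then show ?thesis
      using gen_eigenspace_contracting[of \<mu> A k] ker hyperbolic_projection_zero[OF x gen(1)] by metis
  next
    case False
    then have "Re \<mu> > 0" using that by simp
    then show ?thesis
      using gen_eigenspace_expanding[of \<mu> A k] ker hyperbolic_projection_zero[OF x gen(1)] by metis
  qed
  moreover have mem: "P *v x \<in> gen_eigenspace A \<mu>"
    unfolding gen_eigenspace_def using ker by blast
  ultimately show ?case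
    unfolding center_space_complex_def using eigenvalue_if_gen_eigenvector[OF mem]
    by (cases "P *v x = 0") (auto intro!: vec.span_zero vec.span_base)
next
  case (add P Q)
  then show ?case
    by (simp add: matrix_vector_mult_add_rdistrib center_space_complex_def vec.span_add)
qed

lemma chain_recurrent_set_subset_center:
  fixes A :: "complex^'n^'n"
  shows "chain_recurrent_set norm (linear_flow A) \<subseteq> center_space_complex A"
  using chain_recurrent_spectral_component[OF one_spectral] by auto

section \<open>Points of the center space are chain recurrent\<close>

text \<open>Chains for a single map, with the number of steps explicit because only chains of equal length can
  be added. Zero steps are allowed here, unlike in \<open>is_chain\<close>.\<close>

definition reaches :: "('v::real_normed_vector \<Rightarrow> 'v) \<Rightarrow> real \<Rightarrow> nat \<Rightarrow> 'v \<Rightarrow> 'v \<Rightarrow> bool" where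
  "reaches f \<epsilon> k x y \<longleftrightarrow>
     (\<exists>\<xi>. \<xi> 0 = x \<and> \<xi> k = y \<and> (\<forall>i<k. norm (f (\<xi> i) - \<xi> (Suc i)) < \<epsilon>))"

lemma reaches_trans:
  assumes "reaches f \<epsilon> k x y" "reaches f \<epsilon> l y z"
  shows "reaches f \<epsilon> (k + l) x z"
proof -
  obtain \<xi> where \<xi>: "\<xi> 0 = x" "\<xi> k = y" "\<And>i. i < k \<Longrightarrow> norm (f (\<xi> i) - \<xi> (Suc i)) < \<epsilon>"
    using assms(1) unfolding reaches_def by blast
  obtain \<eta> where \<eta>: "\<eta> 0 = y" "\<eta> l = z" "\<And>i. i < l \<Longrightarrow> norm (f (\<eta> i) - \<eta> (Suc i)) < \<epsilon>"
    using assms(2) unfolding reaches_def by blast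
  let ?\<zeta> = "\<lambda>i. if i < k then \<xi> i else \<eta> (i - k)"
  have "norm (f (?\<zeta> i) - ?\<zeta> (Suc i)) < \<epsilon>" if i: "i < k + l" for i
  proof (cases "i < k")
    case True
    then have "?\<zeta> (Suc i) = \<xi> (Suc i)"
      using \<xi>(2) \<eta>(1) by (cases "Suc i = k") auto
    then show ?thesis using True \<xi>(3) by simp
  next
    case False
    then show ?thesis using i \<eta>(3)[of "i - k"] by (simp add: Suc_diff_le)
  qed
  moreover have "?\<zeta> 0 = x" using \<xi> \<eta> by (cases "k = 0") auto
  moreover have "?\<zeta> (k + l) = z" using \<eta> by simp
  ultimately show ?thesis unfolding reaches_def by (intro exI[of _ ?\<zeta>]) blast
qed

lemma reaches_add:
  assumes add: "\<And>x y. f (x + y) = f x + f y"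
    and "reaches f \<epsilon> k x y" "reaches f \<delta> k x' y'"
  shows "reaches f (\<epsilon> + \<delta>) k (x + x') (y + y')"
proof -
  obtain \<xi> where \<xi>: "\<xi> 0 = x" "\<xi> k = y" "\<And>i. i < k \<Longrightarrow> norm (f (\<xi> i) - \<xi> (Suc i)) < \<epsilon>"
    using assms(2) unfolding reaches_def by blast
  obtain \<eta> where \<eta>: "\<eta> 0 = x'" "\<eta> k = y'" "\<And>i. i < k \<Longrightarrow> norm (f (\<eta> i) - \<eta> (Suc i)) < \<delta>"
    using assms(3) unfolding reaches_def by blast
  have "norm (f (\<xi> i + \<eta> i) - (\<xi> (Suc i) + \<eta> (Suc i))) < \<epsilon> + \<delta>" if "i < k" for i
    unfolding add add_diff_add using norm_add_less[OF \<xi>(3) \<eta>(3)] that by blast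
  then show ?thesis
    unfolding reaches_def using \<xi>(1,2) \<eta>(1,2) by (intro exI[of _ "\<lambda>i. \<xi> i + \<eta> i"]) auto
qed

lemma reaches_scale:
  fixes f :: "complex^'n \<Rightarrow> complex^'n"
  assumes scale: "\<And>x. f (c *s x) = c *s f x" and "c \<noteq> 0" and "reaches f \<epsilon> k x y"
  shows "reaches f (norm c * \<epsilon>) k (c *s x) (c *s y)"
proof -
  obtain \<xi> where \<xi>: "\<xi> 0 = x" "\<xi> k = y" "\<And>i. i < k \<Longrightarrow> norm (f (\<xi> i) - \<xi> (Suc i)) < \<epsilon>"
    using assms(3) unfolding reaches_def by blast
  have "norm (f (c *s \<xi> i) - c *s \<xi> (Suc i)) < norm c * \<epsilon>" if "i < k" for i
    unfolding scale vec.scale_right_diff_distrib[symmetric] norm_vector_mult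
    using \<xi>(3)[OF that] \<open>c \<noteq> 0\<close> by (intro mult_strict_left_mono) auto
  then show ?thesis
    unfolding reaches_def using \<xi>(1,2) by (intro exI[of _ "\<lambda>i. c *s \<xi> i"]) auto
qed

lemma reaches_0_0: "f 0 = 0 \<Longrightarrow> \<epsilon> > 0 \<Longrightarrow> reaches f \<epsilon> k 0 0"
  unfolding reaches_def by (intro exI[of _ "\<lambda>_. 0"]) simp

text \<open>Asking for one length \<open>k\<close> for both directions is harmless, because chains can wait at the origin.\<close>

definition null_connected :: "('v::real_normed_vector \<Rightarrow> 'v) \<Rightarrow> 'v set" where
  "null_connected f = {x. \<forall>\<epsilon>>0. \<exists>k. reaches f \<epsilon> k x 0 \<and> reaches f \<epsilon> k 0 x}"

lemma null_connectedI:
  assumes f0: "f 0 = 0"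
    and "\<And>\<epsilon>. \<epsilon> > 0 \<Longrightarrow> \<exists>k. reaches f \<epsilon> k x 0" "\<And>\<epsilon>. \<epsilon> > 0 \<Longrightarrow> \<exists>k. reaches f \<epsilon> k 0 x"
  shows "x \<in> null_connected f"
  unfolding null_connected_def mem_Collect_eq
proof (intro allI impI)
  fix \<epsilon> :: real assume \<epsilon>: "\<epsilon> > 0"
  obtain k l where kl: "reaches f \<epsilon> k x 0" "reaches f \<epsilon> l 0 x"
    using assms(2,3)[OF \<epsilon>] by blast
  have "reaches f \<epsilon> (k + l) x 0"
    by (rule reaches_trans[OF kl(1) reaches_0_0[of f, OF f0 \<epsilon>]])
  moreover have "reaches f \<epsilon> (k + l) 0 x"
    by (rule reaches_trans[OF reaches_0_0[of f, OF f0 \<epsilon>] kl(2)])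
  ultimately show "\<exists>k. reaches f \<epsilon> k x 0 \<and> reaches f \<epsilon> k 0 x" by blast
qed

lemma subspace_null_connected:
  fixes f :: "complex^'n \<Rightarrow> complex^'n"
  assumes add: "\<And>x y. f (x + y) = f x + f y" and scale: "\<And>c x. f (c *s x) = c *s f x"
  shows "vec.subspace (null_connected f)"
proof (rule vec.subspaceI)
  have f0: "f 0 = 0" using scale[of 0 0] by simp
  show zero: "0 \<in> null_connected f"
    unfolding null_connected_def using reaches_0_0[of f, OF f0] by blast
  fix x y assume x: "x \<in> null_connected f" and y: "y \<in> null_connected f"
  show "x + y \<in> null_connected f"
    unfolding null_connected_def mem_Collect_eq
  proof (intro allI impI)
    fix \<epsilon> :: real assume "\<epsilon> > 0"
    then have \<epsilon>: "\<epsilon> / 2 > 0" by simp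
    obtain k l where k: "reaches f (\<epsilon>/2) k x 0" "reaches f (\<epsilon>/2) k 0 x"
      and l: "reaches f (\<epsilon>/2) l y 0" "reaches f (\<epsilon>/2) l 0 y"
      using x y \<epsilon> unfolding null_connected_def by blast
    note pad = reaches_0_0[of f, OF f0 \<epsilon>]
    have "reaches f (\<epsilon>/2) (k + l) x 0" "reaches f (\<epsilon>/2) (l + k) 0 x"
      by (rule reaches_trans[OF k(1) pad], rule reaches_trans[OF pad k(2)])
    moreover have "reaches f (\<epsilon>/2) (l + k) y 0" "reaches f (\<epsilon>/2) (k + l) 0 y"
      by (rule reaches_trans[OF l(1) pad], rule reaches_trans[OF pad l(2)])
    ultimately have "reaches f (\<epsilon>/2 + \<epsilon>/2) (k + l) (x + y) (0 + 0)"
      "reaches f (\<epsilon>/2 + \<epsilon>/2) (k + l) (0 + 0) (x + y)"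
      unfolding add.commute[of l k] by (blast intro: reaches_add[OF add])+
    then show "\<exists>k. reaches f \<epsilon> k (x + y) 0 \<and> reaches f \<epsilon> k 0 (x + y)"
      by auto
  qed
next
  fix c x assume x: "x \<in> null_connected f"
  have f0: "f 0 = 0" using scale[of 0 0] by simp
  show "c *s x \<in> null_connected f"
  proof (cases "c = 0")
    case True
    then show ?thesis
      unfolding null_connected_def using reaches_0_0[of f, OF f0] by auto
  next
    case False
    show ?thesis
      unfolding null_connected_def mem_Collect_eq
    proof (intro allI impI)
      fix \<epsilon> :: real assume "\<epsilon> > 0"
      then have "\<epsilon> / norm c > 0" using False by simp
      then obtain k where k: "reaches f (\<epsilon> / norm c) k x 0" "reaches f (\<epsilon> / norm c) k 0 x"
        using x unfolding null_connected_def by blast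
      show "\<exists>k. reaches f \<epsilon> k (c *s x) 0 \<and> reaches f \<epsilon> k 0 (c *s x)"
        using reaches_scale[OF scale False k(1)] reaches_scale[OF scale False k(2)] False by auto
    qed
  qed
qed

text \<open>Modulo \<open>W\<close> the map acts on \<open>v\<close> as multiplication by \<open>\<rho>\<close>, so the coefficient of \<open>v\<close> can follow any
  scalar sequence \<open>a\<close> that is almost an orbit of this multiplication. All jumps are multiples of \<open>v\<close>;
  the component in \<open>W\<close> follows the map exactly and is not controlled.\<close>

lemma reaches_steered:
  fixes f :: "complex^'n \<Rightarrow> complex^'n"
  assumes add: "\<And>x y. f (x + y) = f x + f y" and scale: "\<And>c x. f (c *s x) = c *s f x"
    and W: "vec.subspace W" "\<And>w. w \<in> W \<Longrightarrow> f w \<in> W" and v: "f v - \<rho> *s v \<in> W"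
    and a: "\<And>i. i < m \<Longrightarrow> norm (a (Suc i) - \<rho> * a i) * norm v < \<epsilon>"
  shows "\<exists>w\<in>W. reaches f \<epsilon> m (a 0 *s v) (a m *s v + w)"
proof -
  define w where "w = rec_nat 0 (\<lambda>i wi. f wi + a i *s (f v - \<rho> *s v))"
  have w0: "w 0 = 0" and wS: "w (Suc i) = f (w i) + a i *s (f v - \<rho> *s v)" for i
    by (simp_all add: w_def)
  have "w i \<in> W" for i
  proof (induction i)
    case 0
    show ?case unfolding w0 by (rule vec.subspace_0[OF W(1)])
  next
    case (Suc i)
    then show ?case
      unfolding wS by (intro vec.subspace_add vec.subspace_scale W v)
  qed
  moreover have "norm (f (a i *s v + w i) - (a (Suc i) *s v + w (Suc i))) < \<epsilon>" if "i < m" for i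
  proof -
    have "f (a i *s v + w i) - (a (Suc i) *s v + w (Suc i)) = (\<rho> * a i - a (Suc i)) *s v"
      unfolding add scale wS by (simp add: vec_eq_iff algebra_simps)
    then show ?thesis
      using a[OF that] by (simp only: norm_vector_mult norm_minus_commute)
  qed
  ultimately show ?thesis
    unfolding reaches_def
    by (intro bexI[of _ "w m"] exI[of _ "\<lambda>i. a i *s v + w i"]) (auto simp: w0)
qed

text \<open>To reach the origin, the coefficient of \<open>v\<close> is rotated and scaled linearly from 1 to 0, which leaves
  a point \<open>w\<close> of \<open>W\<close> that reaches the origin by assumption. In the other direction the coefficient is
  scaled up from 0 and arrives at \<open>v + w\<close>; adding a chain from the origin to \<open>- w\<close> corrects the error.
  Adding chains adds their jump bounds, so each of the two gets half of the allowed size.\<close>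

lemma null_connected_extend:
  fixes f :: "complex^'n \<Rightarrow> complex^'n"
  assumes add: "\<And>x y. f (x + y) = f x + f y" and scale: "\<And>c x. f (c *s x) = c *s f x"
    and W: "vec.subspace W" "\<And>w. w \<in> W \<Longrightarrow> f w \<in> W" "W \<subseteq> null_connected f"
    and v: "f v - \<rho> *s v \<in> W" and \<rho>: "norm \<rho> = 1"
  shows "v \<in> null_connected f"
proof (rule null_connectedI)
  show f0: "f 0 = 0" using scale[of 0 0] by simp
  fix \<epsilon> :: real assume \<epsilon>: "\<epsilon> > 0"
  obtain m :: nat where "m > norm v / \<epsilon>" using reals_Archimedean2 by blast
  then have "m > 0" using \<epsilon> by (cases m) (auto simp: field_simps dest: less_le_trans)
  have small: "norm v / m < \<epsilon>"
    using \<open>m > norm v / \<epsilon>\<close> \<open>m > 0\<close> \<epsilon> by (simp add: field_simps)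
  show "\<exists>k. reaches f \<epsilon> k v 0"
  proof -
    \<comment> \<open>the coefficient falls linearly from 1 to 0 in the frame that rotates with \<open>\<rho>\<close>\<close>
    define a where "a i = \<rho> ^ i * of_real (1 - i / m)" for i :: nat
    have "norm (a (Suc i) - \<rho> * a i) * norm v < \<epsilon>" for i
    proof -
      have "a (Suc i) - \<rho> * a i = \<rho> ^ Suc i * of_real (- 1 / m)"
        unfolding a_def using \<open>m > 0\<close> by (simp add: field_simps)
      then show ?thesis using small \<rho> by (simp add: norm_mult norm_power norm_divide)
    qed
    from reaches_steered[of f W v \<rho> m a, OF add scale W(1,2) v this] obtain w
      where w: "w \<in> W" "reaches f \<epsilon> m v w"
      using \<open>m > 0\<close> by (auto simp: a_def)
    then obtain k where "reaches f \<epsilon> k w 0"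
      using W(3) \<epsilon> unfolding null_connected_def by blast
    with w(2) show ?thesis using reaches_trans by blast
  qed
next
  fix \<epsilon> :: real assume "\<epsilon> > 0"
  then have \<epsilon>: "\<epsilon> / 2 > 0" by simp
  have f0: "f 0 = 0" using scale[of 0 0] by simp
  obtain m :: nat where "m > norm v / (\<epsilon> / 2)" using reals_Archimedean2 by blast
  then have "m > 0" using \<epsilon> by (cases m) (auto simp: field_simps dest: less_le_trans)
  have small: "norm v / m < \<epsilon> / 2"
    using \<open>m > norm v / (\<epsilon> / 2)\<close> \<open>m > 0\<close> \<epsilon> by (simp add: field_simps)
  have "\<rho> \<noteq> 0" using \<rho> by auto
  show "\<exists>k. reaches f \<epsilon> k 0 v"
  proof -
    \<comment> \<open>the factor \<open>inverse (\<rho> ^ m)\<close> sets the phase so that the coefficient is 1 after \<open>m\<close> steps\<close>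
    define a where "a i = inverse (\<rho> ^ m) * \<rho> ^ i * of_real (i / m)" for i :: nat
    have "norm (a (Suc i) - \<rho> * a i) * norm v < \<epsilon> / 2" for i
    proof -
      have "a (Suc i) - \<rho> * a i = inverse (\<rho> ^ m) * \<rho> ^ Suc i * of_real (1 / m)"
        unfolding a_def by (simp add: algebra_simps add_divide_distrib)
      then show ?thesis
        using small \<rho> by (simp add: norm_mult norm_power norm_divide norm_inverse)
    qed
    from reaches_steered[of f W v \<rho> m a, OF add scale W(1,2) v this] obtain w
      where w: "w \<in> W" "reaches f (\<epsilon>/2) m 0 (v + w)"
      using \<open>m > 0\<close> \<open>\<rho> \<noteq> 0\<close> by (auto simp: a_def)
    have "- w \<in> null_connected f"
      using W(1,3) w(1) vec.subspace_neg by blast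
    then obtain k where k: "reaches f (\<epsilon>/2) k 0 (- w)"
      using \<epsilon> unfolding null_connected_def by blast
    note pad = reaches_0_0[of f, OF f0 \<epsilon>]
    have "reaches f (\<epsilon>/2 + \<epsilon>/2) (k + m) (0 + 0) ((v + w) + - w)"
      using reaches_trans[OF pad w(2), of k] reaches_trans[OF pad k, of m]
      by (intro reaches_add[OF add]) (simp_all add: add.commute)
    then show ?thesis by auto
  qed
qed

lemma subspace_kernel: "vec.subspace {v. M *v v = 0}"
  by (rule vec.subspaceI) (simp_all add: matrix_vector_right_distrib vec.scale)

text \<open>With \<open>W\<close> the kernel of \<open>(A - \<mu>)\<^sup>k\<close>: for \<open>v\<close> in the next kernel, \<open>(A - \<mu>)\<^sup>k v\<close> is an eigenvector
  or zero, so the flow multiplies it by \<open>e\<^sup>\<mu>\<^sup>T\<close>, a number of modulus 1.\<close>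

lemma gen_eigenspace_null_connected:
  fixes A :: "complex^'n^'n"
  assumes "Re \<mu> = 0"
  shows "matrix_power (A - mat \<mu>) k *v v = 0 \<Longrightarrow> v \<in> null_connected (linear_flow A T)"
proof (induction k arbitrary: v)
  case 0
  have "linear_flow A T 0 = 0"
    by (simp add: linear_flow_def)
  then show ?case
    using 0 reaches_0_0[of "linear_flow A T"] by (auto simp: null_connected_def)
next
  case (Suc k)
  let ?M = "matrix_power (A - mat \<mu>) k" and ?f = "linear_flow A T" and ?\<rho> = "exp (of_real T * \<mu>)"
  have add: "?f (x + y) = ?f x + ?f y" and scale: "?f (c *s x) = c *s ?f x" for x y c
    by (simp_all add: linear_flow_def matrix_vector_right_distrib vec.scale)
  have "(A - mat \<mu>) ** A = A ** (A - mat \<mu>)"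
    by (rule shift_commute) simp
  then have comm: "?M *v ?f x = ?f (?M *v x)" for x
    by (intro linear_flow_commutes matrix_power_commute)
  have "?f (?M *v v) = ?\<rho> *s (?M *v v)"
  proof -
    have "matrix_power (A - mat \<mu>) 1 *v (?M *v v) = 0"
      using Suc.prems by (simp add: matrix_vector_mul_assoc)
    from linear_flow_gen_eigenvector[OF this] show ?thesis
      by (simp add: nilpotent_exp_def)
  qed
  then have v: "?f v - ?\<rho> *s v \<in> {v. ?M *v v = 0}"
    by (simp add: comm vec.diff vec.scale)
  have inv: "?f w \<in> {v. ?M *v v = 0}" if "w \<in> {v. ?M *v v = 0}" for w
    using that by (simp add: comm) (simp add: linear_flow_def)
  have "norm ?\<rho> = 1" using assms by simp
  then show ?case
    using null_connected_extend[of ?f, OF add scale subspace_kernel inv _ v] Suc.IH by blast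
qed

lemma center_subset_chain_recurrent_set:
  fixes A :: "complex^'n^'n"
  shows "center_space_complex A \<subseteq> chain_recurrent_set norm (linear_flow A)"
proof
  fix x assume x: "x \<in> center_space_complex A"
  show "x \<in> chain_recurrent_set norm (linear_flow A)"
    unfolding chain_recurrent_set_def mem_Collect_eq
  proof (intro allI impI)
    fix \<epsilon> T :: real assume "\<epsilon> > 0" "T > 0"
    let ?f = "linear_flow A T"
    have add: "?f (x + y) = ?f x + ?f y" and scale: "?f (c *s x) = c *s ?f x" for x y c
      by (simp_all add: linear_flow_def matrix_vector_right_distrib vec.scale)
    have "center_space_complex A \<subseteq> null_connected ?f"
      unfolding center_space_complex_def
    proof (rule vec.span_minimal)
      show "(\<Union>\<mu>\<in>{\<mu>. eigenvalue A \<mu> \<and> Re \<mu> = 0}. gen_eigenspace A \<mu>) \<subseteq> null_connected ?f"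
        using gen_eigenspace_null_connected by (auto simp: gen_eigenspace_def)
    qed (rule subspace_null_connected[OF add scale])
    with x \<open>\<epsilon> > 0\<close> obtain k where "reaches ?f \<epsilon> k x 0" "reaches ?f \<epsilon> k 0 x"
      unfolding null_connected_def by blast
    \<comment> \<open>an extra step at the origin, since a chain needs at least one step and \<open>k\<close> may be 0\<close>
    moreover have "reaches ?f \<epsilon> 1 0 0"
      using \<open>\<epsilon> > 0\<close> by (intro reaches_0_0) (simp_all add: linear_flow_def)
    ultimately have "reaches ?f \<epsilon> (k + (1 + k)) x x"
      by (intro reaches_trans)
    then show "is_chain norm (linear_flow A) \<epsilon> T x x"
      unfolding is_chain_def reaches_def
      by (intro exI[of _ "k + (1 + k)"] conjI exI[of _ "\<lambda>_. T"]) auto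
  qed
qed

theorem chain_recurrent_set_complex:
  fixes A :: "complex^'n^'n"
  assumes "is_vec_norm N"
  shows "chain_recurrent_set N (linear_flow A) = center_space_complex A"
  unfolding chain_recurrent_set_vec_norm[OF assms]
  using chain_recurrent_set_subset_center center_subset_chain_recurrent_set by blast

section \<open>Real matrices\<close>

definition complexify_vec :: "real^'n \<Rightarrow> complex^'n" where
  "complexify_vec x = (\<chi> i. complex_of_real (x $ i))"

definition Re_vec :: "complex^'n \<Rightarrow> real^'n" where
  "Re_vec v = (\<chi> i. Re (v $ i))"

definition Im_vec :: "complex^'n \<Rightarrow> real^'n" where
  "Im_vec v = (\<chi> i. Im (v $ i))"

definition cnj_vec :: "complex^'n \<Rightarrow> complex^'n" where
  "cnj_vec v = (\<chi> i. cnj (v $ i))"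

lemma bounded_linear_complexify_vec: "bounded_linear complexify_vec"
  unfolding linear_conv_bounded_linear[symmetric]
  by (intro linearI) (simp_all add: complexify_vec_def vec_eq_iff, simp add: scaleR_conv_of_real)

lemma bounded_linear_Re_vec: "bounded_linear Re_vec"
  unfolding linear_conv_bounded_linear[symmetric]
  by (intro linearI) (simp_all add: Re_vec_def vec_eq_iff)

lemma complexify_mult: "complexify_vec (A *v x) = complexify A *v complexify_vec x"
  by (simp add: complexify_vec_def vec_eq_iff matrix_vector_mult_def map_matrix_def)

lemma Re_vec_mult: "Re_vec (complexify A *v v) = A *v Re_vec v"
  by (simp add: Re_vec_def vec_eq_iff matrix_vector_mult_def map_matrix_def Re_sum)

lemma cnj_vec_mult: "cnj_vec (complexify A *v v) = complexify A *v cnj_vec v"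
  by (simp add: cnj_vec_def vec_eq_iff matrix_vector_mult_def map_matrix_def cnj_sum)

text \<open>A matrix with real entries commutes with conjugation.\<close>

lemma cnj_vec_gen_eigenspace:
  assumes "v \<in> gen_eigenspace (complexify A) \<mu>"
  shows "cnj_vec v \<in> gen_eigenspace (complexify A) (cnj \<mu>)"
proof -
  let ?N = "\<lambda>\<mu>. complexify A - mat \<mu>"
  have N: "cnj_vec (?N \<mu> *v w) = ?N (cnj \<mu>) *v cnj_vec w" for w
  proof -
    have "cnj_vec (complexify A *v w - \<mu> *s w) = cnj_vec (complexify A *v w) - cnj \<mu> *s cnj_vec w"
      by (simp add: cnj_vec_def vec_eq_iff)
    then show ?thesis
      by (simp add: matrix_vector_mult_diff_rdistrib mat_vector_mult cnj_vec_mult)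
  qed
  have pow: "cnj_vec (matrix_power (?N \<mu>) k *v v) = matrix_power (?N (cnj \<mu>)) k *v cnj_vec v" for k
    by (induction k) (simp_all add: matrix_vector_mul_assoc[symmetric] N)
  obtain k where "matrix_power (?N \<mu>) k *v v = 0"
    using assms by (auto simp: gen_eigenspace_def)
  then have "matrix_power (?N (cnj \<mu>)) k *v cnj_vec v = 0"
    using pow[of k] by (simp add: cnj_vec_def zero_vec_def)
  then show ?thesis by (auto simp: gen_eigenspace_def)
qed

lemma gen_eigenspace_subset_center:
  assumes "v \<in> gen_eigenspace A \<mu>" "Re \<mu> = 0"
  shows "v \<in> center_space_complex A"
  unfolding center_space_complex_def using assms eigenvalue_if_gen_eigenvector[OF assms(1)]
  by (cases "v = 0") (auto intro!: vec.span_zero vec.span_base)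

text \<open>\<open>Re v\<close> and \<open>Im v\<close> are complex combinations of \<open>v\<close> and its conjugate, which belongs to the conjugate
  eigenvalue and hence to the center space as well.\<close>

lemma complexify_center_space:
  fixes A :: "real^'n^'n"
  assumes "x \<in> center_space_real A"
  shows "complexify_vec x \<in> center_space_complex (complexify A)"
proof -
  let ?C = "center_space_complex (complexify A)"
  have C: "vec.subspace ?C"
    unfolding center_space_complex_def by (rule vec.subspace_span)
  let ?S = "{x. complexify_vec x \<in> ?C}"
  interpret bounded_linear complexify_vec by (rule bounded_linear_complexify_vec)
  have scale: "complexify_vec (r *\<^sub>R x) = of_real r *s complexify_vec x" for r and x :: "real^'n"
    by (simp add: complexify_vec_def vec_eq_iff)
  have S: "subspace ?S"
    by (rule subspaceI)
      (simp_all add: zero add scale vec.subspace_0[OF C] vec.subspace_add[OF C] vec.subspace_scale[OF C])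
  have gen: "Re_vec v \<in> ?S" "Im_vec v \<in> ?S"
    if v: "v \<in> gen_eigenspace (complexify A) \<mu>" and \<mu>: "Re \<mu> = 0" for v \<mu>
  proof -
    have "v \<in> ?C" "cnj_vec v \<in> ?C"
      using gen_eigenspace_subset_center[OF v \<mu>]
        gen_eigenspace_subset_center[OF cnj_vec_gen_eigenspace[OF v]] \<mu> by auto
    then have sum: "(1/2) *s (v + cnj_vec v) \<in> ?C" and diff: "(- \<i>/2) *s (v - cnj_vec v) \<in> ?C"
      using C vec.subspace_add vec.subspace_diff vec.subspace_scale by blast+
    have "complexify_vec (Re_vec v) = (1/2) *s (v + cnj_vec v)"
      by (simp add: complexify_vec_def Re_vec_def cnj_vec_def vec_eq_iff complex_eq_iff)
    moreover have "complexify_vec (Im_vec v) = (- \<i>/2) *s (v - cnj_vec v)"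
      by (simp add: complexify_vec_def Im_vec_def cnj_vec_def vec_eq_iff complex_eq_iff)
    ultimately show "Re_vec v \<in> ?S" "Im_vec v \<in> ?S"
      using sum diff by simp_all
  qed
  have "center_space_real A \<subseteq> ?S"
    unfolding center_space_real_def real_gen_eigenspace_def
    using gen by (intro span_minimal UN_least S) (auto simp: Re_vec_def Im_vec_def)
  then show ?thesis using assms by blast
qed

text \<open>Complex multiples mix real and imaginary parts, so the induction over the complex span has to carry
  both parts along.\<close>

lemma Re_vec_center_space:
  fixes A :: "real^'n^'n"
  assumes "v \<in> center_space_complex (complexify A)"
  shows "Re_vec v \<in> center_space_real A"
proof -
  let ?R = "center_space_real A"
  have R: "subspace ?R" unfolding center_space_real_def by (rule subspace_span)
  let ?S = "{v. Re_vec v \<in> ?R \<and> Im_vec v \<in> ?R}"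
  have S: "vec.subspace ?S"
  proof (rule vec.subspaceI)
    have "Re_vec (0 :: complex^'n) = 0" "Im_vec (0 :: complex^'n) = 0"
      by (simp_all add: Re_vec_def Im_vec_def vec_eq_iff)
    then show "0 \<in> ?S" using subspace_0[OF R] by simp
  next
    fix v w assume "v \<in> ?S" "w \<in> ?S"
    moreover have "Re_vec (v + w) = Re_vec v + Re_vec w" "Im_vec (v + w) = Im_vec v + Im_vec w"
      by (simp_all add: Re_vec_def Im_vec_def vec_eq_iff)
    ultimately show "v + w \<in> ?S" using subspace_add[OF R] by simp
  next
    fix c v assume "v \<in> ?S"
    moreover have "Re_vec (c *s v) = Re c *\<^sub>R Re_vec v - Im c *\<^sub>R Im_vec v"
      "Im_vec (c *s v) = Re c *\<^sub>R Im_vec v + Im c *\<^sub>R Re_vec v"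
      by (simp_all add: Re_vec_def Im_vec_def vec_eq_iff)
    ultimately show "c *s v \<in> ?S"
      using R by (simp add: subspace_add subspace_diff subspace_scale)
  qed
  have "center_space_complex (complexify A) \<subseteq> ?S"
    unfolding center_space_complex_def
  proof (intro vec.span_minimal UN_least S subsetI)
    fix \<mu> v
    assume \<mu>: "\<mu> \<in> {\<mu>. eigenvalue (complexify A) \<mu> \<and> Re \<mu> = 0}"
      and v: "v \<in> gen_eigenspace (complexify A) \<mu>"
    have "{Re_vec v, Im_vec v} \<subseteq> real_gen_eigenspace A \<mu>"
      unfolding real_gen_eigenspace_def Re_vec_def Im_vec_def using v by (blast intro: span_base)
    then show "v \<in> ?S"
      using \<mu> unfolding center_space_real_def by (auto intro!: span_base)
  qed
  then show ?thesis using assms by blast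
qed

theorem chain_recurrent_set_real:
  fixes A :: "real^'n^'n"
  assumes "is_vec_norm N"
  shows "chain_recurrent_set N (linear_flow A) = center_space_real A"
proof -
  let ?c = "complexify_vec :: real^'n \<Rightarrow> complex^'n" and ?r = "Re_vec :: complex^'n \<Rightarrow> real^'n"
  let ?CR = "chain_recurrent_set norm (linear_flow A)"
  have complex: "chain_recurrent_set norm (linear_flow (complexify A)) = center_space_complex (complexify A)"
    using chain_recurrent_set_subset_center center_subset_chain_recurrent_set by blast
  have Re_complexify: "?r (?c x) = x" for x
    by (simp add: Re_vec_def complexify_vec_def vec_eq_iff)
  have "x \<in> center_space_real A" if x: "x \<in> ?CR" for x
  proof -
    obtain C where C: "C > 0" "\<And>x. norm (?c x) \<le> norm x * C"
      using bounded_linear.pos_bounded[OF bounded_linear_complexify_vec] by blast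
    have "?c x \<in> chain_recurrent_set norm (linear_flow (complexify A))"
    proof (rule chain_recurrent_image[OF _ _ _ C(1) x])
      show "?c (x - y) = ?c x - ?c y" for x y
        by (rule linear_diff[OF bounded_linear.linear[OF bounded_linear_complexify_vec]])
      show "?c (linear_flow A t x) = linear_flow (complexify A) t (?c x)" for t x
        by (rule linear_flow_intertwine[OF bounded_linear_complexify_vec complexify_mult])
      show "norm (?c x) \<le> C * norm x" for x
        using C(2)[of x] by (simp add: mult.commute)
    qed
    then show ?thesis
      using Re_vec_center_space[of "?c x" A] complex Re_complexify[of x] by simp
  qed
  moreover have "x \<in> ?CR" if x: "x \<in> center_space_real A" for x
  proof -
    obtain C where C: "C > 0" "\<And>x. norm (?r x) \<le> norm x * C"
      using bounded_linear.pos_bounded[OF bounded_linear_Re_vec] by blast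
    have cx: "?c x \<in> chain_recurrent_set norm (linear_flow (complexify A))"
      unfolding complex using x by (rule complexify_center_space)
    have "?r (?c x) \<in> ?CR"
    proof (rule chain_recurrent_image[OF _ _ _ C(1) cx])
      show "?r (x - y) = ?r x - ?r y" for x y
        by (rule linear_diff[OF bounded_linear.linear[OF bounded_linear_Re_vec]])
      show "?r (linear_flow (complexify A) t x) = linear_flow A t (?r x)" for t x
        by (rule linear_flow_intertwine[OF bounded_linear_Re_vec Re_vec_mult])
      show "norm (?r x) \<le> C * norm x" for x
        using C(2)[of x] by (simp add: mult.commute)
    qed
    then show ?thesis by (simp add: Re_complexify)
  qed
  ultimately show ?thesis
    unfolding chain_recurrent_set_vec_norm[OF assms] by blast
qed

theorem theorem3p2:
  shows "(\<forall>(A :: real^'n^'n) N. is_vec_norm N \<longrightarrow>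
            chain_recurrent_set N (linear_flow A) = center_space_real A) \<and>
         (\<forall>(A :: complex^'n^'n) N. is_vec_norm N \<longrightarrow>
            chain_recurrent_set N (linear_flow A) = center_space_complex A)"
  using chain_recurrent_set_real chain_recurrent_set_complex by blast

end
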